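(* The class $\{\mathbb{R}_\lambda:\lambda\text{ is a transfinite }\times\text{-number}\}$ and the class $\{\mathcal{R}_\lambda:\lambda\text{ is a transfinite }\times\text{-number}\}$ are proper classes.
   Context: Work in Morse–Kelley class theory. $\otimes$ is the natural (Hessenberg) product of ordinals; $\lambda$ is a transfinite $\times$-number if $\omega\le\lambda$ and $\beta\otimes\gamma<\lambda$ for all $\beta,\gamma<\lambda$. $\mathbb{Z}_\infty$ is the class of pairs $(\alpha,\beta)$ of ordinals whose Cantor normal forms share no exponent (viewed as finite sums $\sum\omega^\zeta c_\zeta$ with integer coefficients, with the induced ring operations using natural sum of exponents, and the order in which such an element is compared first on its leading terms); $\mathbb{Z}_\lambda$ consists of those with both coordinates $<\lambda$. $\mathbb{Q}_\infty$ is the class of pairs $(a,b)$ of Surintegers with $b$ positive nonzero and with only $\pm1$ as common divisors, ordered by $(a,b)\preceq(c,d)$ iff $ad\le bc$; $\mathbb{Q}_\lambda$ consists of those with $a,b\in\mathbb{Z}_\lambda$. A $\lambda$-cut is a set $L\subsetneq\mathbb{Q}_\lambda$ with no greatest element such that every element of $L$ is $\prec$ every element of $\mathbb{Q}_\lambda\setminus L$; $\mathbb{R}_\lambda$ is the set of all $\lambda$-cuts, and $\mathcal{R}_\lambda$ is the 8-tuple consisting of $\mathbb{R}_\lambda$ together with its inclusion order, cut addition, negation, multiplication, inversion, and the cuts $\tilde0=\{q<0\}$, $\tilde1=\{q<1\}$. *)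

theory Defs
  imports Main
begin

text \<open>
  Morse--Kelley class theory, shallowly embedded: the elements of \<open>'a\<close> are the sets, and the
  classes are the HOL sets over \<open>'a\<close>. Extensionality and full (impredicative) comprehension for
  classes hold in HOL; global choice is provided by the choice operator of HOL.
\<close>

class mk_universe =
  fixes elts :: "'a \<Rightarrow> 'a set"
  assumes mk_extensionality: "elts x = elts y \<Longrightarrow> x = y"
    and mk_subset: "X \<subseteq> elts x \<Longrightarrow> \<exists>y. elts y = X"
    and mk_pairing: "\<exists>z. elts z = {x, y}"
    and mk_union: "\<exists>y. elts y = (\<Union>z\<in>elts x. elts z)"
    and mk_power: "\<exists>y. elts y = {z. elts z \<subseteq> elts x}"
    and mk_replacement: "\<exists>y. elts y = f ` elts x"
    and mk_foundation: "X \<noteq> {} \<Longrightarrow> \<exists>x\<in>X. elts x \<inter> X = {}"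
    and mk_infinity: "\<exists>x. (\<exists>e\<in>elts x. elts e = {}) \<and>
                         (\<forall>y\<in>elts x. \<exists>z\<in>elts x. elts z = insert y (elts y))"

definition is_set :: "'a::mk_universe set \<Rightarrow> bool" where
  "is_set X \<longleftrightarrow> (\<exists>x. elts x = X)"

definition proper_class :: "'a::mk_universe set \<Rightarrow> bool" where
  "proper_class X \<longleftrightarrow> \<not> is_set X"

text \<open>Meaningful only when \<open>is_set X\<close>.\<close>
definition set_of :: "'a::mk_universe set \<Rightarrow> 'a" where
  "set_of X = (THE x. elts x = X)"

definition kpair :: "'a::mk_universe \<Rightarrow> 'a \<Rightarrow> 'a" where
  "kpair x y = set_of {set_of {x}, set_of {x, y}}"

definition kfst :: "'a::mk_universe \<Rightarrow> 'a" where
  "kfst p = (THE x. \<exists>y. p = kpair x y)"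

definition ksnd :: "'a::mk_universe \<Rightarrow> 'a" where
  "ksnd p = (THE y. \<exists>x. p = kpair x y)"

definition mem_rel :: "('a::mk_universe \<times> 'a) set" where
  "mem_rel = {(x, y). x \<in> elts y}"

lemma wf_mem_rel: "wf (mem_rel :: ('a::mk_universe \<times> 'a) set)"
proof (rule wfI_min)
  fix x :: 'a and Q :: "'a set"
  assume "x \<in> Q"
  then show "\<exists>z\<in>Q. \<forall>y. (y, z) \<in> mem_rel \<longrightarrow> y \<notin> Q"
    using mk_foundation[of Q] by (auto simp: mem_rel_def)
qed


section \<open>Ordinals and Cantor normal forms\<close>

text \<open>Von Neumann ordinals; the strict order is \<open>\<alpha> \<in> elts \<beta>\<close>.\<close>
definition is_ord :: "'a::mk_universe \<Rightarrow> bool" where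
  "is_ord x \<longleftrightarrow> (\<forall>y\<in>elts x. elts y \<subseteq> elts x) \<and> (\<forall>y\<in>elts x. \<forall>z\<in>elts y. elts z \<subseteq> elts y)"

fun nat_ord :: "nat \<Rightarrow> 'a::mk_universe" where
  "nat_ord 0 = set_of {}"
| "nat_ord (Suc n) = set_of (insert (nat_ord n) (elts (nat_ord n)))"

definition omega :: "'a::mk_universe" where
  "omega = set_of (range nat_ord)"

function oadd :: "'a::mk_universe \<Rightarrow> 'a \<Rightarrow> 'a" where
  "oadd \<alpha> \<beta> = set_of (elts \<alpha> \<union> (\<lambda>\<gamma>. oadd \<alpha> \<gamma>) ` elts \<beta>)"
  by pat_completeness auto
termination
  by (relation "inv_image mem_rel snd") (simp add: wf_mem_rel, simp add: mem_rel_def)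

declare oadd.simps [simp del]

function omul :: "'a::mk_universe \<Rightarrow> 'a \<Rightarrow> 'a" where
  "omul \<alpha> \<beta> = set_of (\<Union>\<gamma>\<in>elts \<beta>. elts (oadd (omul \<alpha> \<gamma>) \<alpha>))"
  by pat_completeness auto
termination
  by (relation "inv_image mem_rel snd") (simp add: wf_mem_rel, simp add: mem_rel_def)

declare omul.simps [simp del]

text \<open>Ordinal exponentiation with base \<open>\<omega>\<close>: the supremum of \<open>1\<close> and of all
  \<open>\<omega>\<^sup>\<gamma> \<cdot> \<omega>\<close> with \<open>\<gamma> < \<beta>\<close>.\<close>
function omega_pow :: "'a::mk_universe \<Rightarrow> 'a" where
  "omega_pow \<beta> = set_of (insert (set_of {}) (\<Union>\<gamma>\<in>elts \<beta>. elts (omul (omega_pow \<gamma>) omega)))"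
  by pat_completeness auto
termination
  by (relation mem_rel) (simp add: wf_mem_rel, simp add: mem_rel_def)

declare omega_pow.simps [simp del]

definition cnf_value :: "('a::mk_universe \<times> nat) list \<Rightarrow> 'a" where
  "cnf_value xs = foldr (\<lambda>(\<zeta>, c) s. oadd (omul (omega_pow \<zeta>) (nat_ord c)) s) xs (nat_ord 0)"

definition is_cnf :: "('a::mk_universe \<times> nat) list \<Rightarrow> 'a \<Rightarrow> bool" where
  "is_cnf xs \<alpha> \<longleftrightarrow> sorted_wrt (\<lambda>x y. fst y \<in> elts (fst x)) xs \<and>
     (\<forall>(\<zeta>, c)\<in>set xs. is_ord \<zeta> \<and> 0 < c) \<and> cnf_value xs = \<alpha>"

definition cnf_coeff :: "'a::mk_universe \<Rightarrow> 'a \<Rightarrow> nat" where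
  "cnf_coeff \<alpha> \<zeta> = (case map_of (THE xs. is_cnf xs \<alpha>) \<zeta> of None \<Rightarrow> 0 | Some c \<Rightarrow> c)"

definition ord_of_coeffs :: "('a::mk_universe \<Rightarrow> nat) \<Rightarrow> 'a" where
  "ord_of_coeffs f = (THE \<alpha>. is_ord \<alpha> \<and> cnf_coeff \<alpha> = f)"

definition natural_sum :: "'a::mk_universe \<Rightarrow> 'a \<Rightarrow> 'a" where
  "natural_sum \<alpha> \<beta> = ord_of_coeffs (\<lambda>\<zeta>. cnf_coeff \<alpha> \<zeta> + cnf_coeff \<beta> \<zeta>)"

text \<open>Product of two finite sums \<open>\<Sum>\<omega>\<^sup>\<zeta> c\<^sub>\<zeta>\<close>, with exponents added by the natural sum.\<close>
definition conv :: "('a::mk_universe \<Rightarrow> 'b::comm_semiring_1) \<Rightarrow> ('a \<Rightarrow> 'b) \<Rightarrow> 'a \<Rightarrow> 'b" where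
  "conv f g \<zeta> = (\<Sum>(\<xi>, \<eta>) \<in> {(\<xi>, \<eta>). f \<xi> \<noteq> 0 \<and> g \<eta> \<noteq> 0 \<and> natural_sum \<xi> \<eta> = \<zeta>}. f \<xi> * g \<eta>)"

definition natural_prod :: "'a::mk_universe \<Rightarrow> 'a \<Rightarrow> 'a" where
  "natural_prod \<alpha> \<beta> = ord_of_coeffs (conv (cnf_coeff \<alpha>) (cnf_coeff \<beta>))"

definition transfinite_times_number :: "'a::mk_universe \<Rightarrow> bool" where
  "transfinite_times_number l \<longleftrightarrow> is_ord l \<and> elts omega \<subseteq> elts l \<and>
     (\<forall>\<beta>\<in>elts l. \<forall>\<gamma>\<in>elts l. natural_prod \<beta> \<gamma> \<in> elts l)"


section \<open>Surintegers\<close>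

definition surints :: "'a::mk_universe set" where
  "surints = {kpair \<alpha> \<beta> |\<alpha> \<beta>. is_ord \<alpha> \<and> is_ord \<beta> \<and>
                 (\<forall>\<zeta>. cnf_coeff \<alpha> \<zeta> = 0 \<or> cnf_coeff \<beta> \<zeta> = 0)}"

definition surints_below :: "'a::mk_universe \<Rightarrow> 'a set" where
  "surints_below l = {z \<in> surints. kfst z \<in> elts l \<and> ksnd z \<in> elts l}"

definition z_coeff :: "'a::mk_universe \<Rightarrow> 'a \<Rightarrow> int" where
  "z_coeff z \<zeta> = int (cnf_coeff (kfst z) \<zeta>) - int (cnf_coeff (ksnd z) \<zeta>)"

definition z_of_coeffs :: "('a::mk_universe \<Rightarrow> int) \<Rightarrow> 'a" where
  "z_of_coeffs f = kpair (ord_of_coeffs (\<lambda>\<zeta>. nat (f \<zeta>))) (ord_of_coeffs (\<lambda>\<zeta>. nat (- f \<zeta>)))"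

definition z_zero :: "'a::mk_universe" where
  "z_zero = kpair (nat_ord 0) (nat_ord 0)"

definition z_one :: "'a::mk_universe" where
  "z_one = kpair (nat_ord 1) (nat_ord 0)"

definition z_add :: "'a::mk_universe \<Rightarrow> 'a \<Rightarrow> 'a" where
  "z_add x y = z_of_coeffs (\<lambda>\<zeta>. z_coeff x \<zeta> + z_coeff y \<zeta>)"

definition z_neg :: "'a::mk_universe \<Rightarrow> 'a" where
  "z_neg x = z_of_coeffs (\<lambda>\<zeta>. - z_coeff x \<zeta>)"

definition z_mul :: "'a::mk_universe \<Rightarrow> 'a \<Rightarrow> 'a" where
  "z_mul x y = z_of_coeffs (conv (z_coeff x) (z_coeff y))"

text \<open>The coefficients are compared at the largest exponent where they differ.\<close>
definition z_less :: "'a::mk_universe \<Rightarrow> 'a \<Rightarrow> bool" where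
  "z_less x y \<longleftrightarrow> (\<exists>\<zeta>. is_ord \<zeta> \<and> z_coeff x \<zeta> < z_coeff y \<zeta> \<and>
     (\<forall>\<eta>. is_ord \<eta> \<and> \<zeta> \<in> elts \<eta> \<longrightarrow> z_coeff x \<eta> = z_coeff y \<eta>))"

definition z_le :: "'a::mk_universe \<Rightarrow> 'a \<Rightarrow> bool" where
  "z_le x y \<longleftrightarrow> z_less x y \<or> x = y"

definition z_dvd :: "'a::mk_universe \<Rightarrow> 'a \<Rightarrow> bool" where
  "z_dvd d x \<longleftrightarrow> (\<exists>e\<in>surints. x = z_mul d e)"


section \<open>Surrationals\<close>

definition surrats :: "'a::mk_universe set" where
  "surrats = {kpair a b |a b. a \<in> surints \<and> b \<in> surints \<and> z_less z_zero b \<and>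
     (\<forall>d\<in>surints. z_dvd d a \<and> z_dvd d b \<longrightarrow> d = z_one \<or> d = z_neg z_one)}"

definition surrats_below :: "'a::mk_universe \<Rightarrow> 'a set" where
  "surrats_below l = {q \<in> surrats. kfst q \<in> surints_below l \<and> ksnd q \<in> surints_below l}"

definition q_le :: "'a::mk_universe \<Rightarrow> 'a \<Rightarrow> bool" where
  "q_le p q \<longleftrightarrow> z_le (z_mul (kfst p) (ksnd q)) (z_mul (ksnd p) (kfst q))"

definition q_less :: "'a::mk_universe \<Rightarrow> 'a \<Rightarrow> bool" where
  "q_less p q \<longleftrightarrow> q_le p q \<and> p \<noteq> q"

text \<open>The reduced representative of the fraction \<open>a / b\<close>, for \<open>b\<close> nonzero.\<close>
definition q_frac :: "'a::mk_universe \<Rightarrow> 'a \<Rightarrow> 'a" where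
  "q_frac a b = (THE q. q \<in> surrats \<and> z_mul (kfst q) b = z_mul (ksnd q) a)"

definition q_zero :: "'a::mk_universe" where
  "q_zero = kpair z_zero z_one"

definition q_one :: "'a::mk_universe" where
  "q_one = kpair z_one z_one"

definition q_add :: "'a::mk_universe \<Rightarrow> 'a \<Rightarrow> 'a" where
  "q_add p q = q_frac (z_add (z_mul (kfst p) (ksnd q)) (z_mul (ksnd p) (kfst q)))
                      (z_mul (ksnd p) (ksnd q))"

definition q_neg :: "'a::mk_universe \<Rightarrow> 'a" where
  "q_neg q = kpair (z_neg (kfst q)) (ksnd q)"

definition q_mul :: "'a::mk_universe \<Rightarrow> 'a \<Rightarrow> 'a" where
  "q_mul p q = q_frac (z_mul (kfst p) (kfst q)) (z_mul (ksnd p) (ksnd q))"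

definition q_inv :: "'a::mk_universe \<Rightarrow> 'a" where
  "q_inv q = q_frac (ksnd q) (kfst q)"


section \<open>Cuts\<close>

text \<open>The empty set is admitted as a cut; \<open>surrats_below l\<close> is not.\<close>
definition is_cut :: "'a::mk_universe \<Rightarrow> 'a \<Rightarrow> bool" where
  "is_cut l L \<longleftrightarrow> elts L \<subset> surrats_below l \<and>
     \<not> (\<exists>m\<in>elts L. \<forall>q\<in>elts L. q_le q m) \<and>
     (\<forall>p\<in>elts L. \<forall>q\<in>surrats_below l - elts L. q_less p q)"

definition real_set :: "'a::mk_universe \<Rightarrow> 'a" where
  "real_set l = set_of {L. is_cut l L}"

definition cut_zero :: "'a::mk_universe \<Rightarrow> 'a set" where
  "cut_zero l = {q \<in> surrats_below l. q_less q q_zero}"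

definition cut_one :: "'a::mk_universe \<Rightarrow> 'a set" where
  "cut_one l = {q \<in> surrats_below l. q_less q q_one}"

definition cut_add :: "'a::mk_universe set \<Rightarrow> 'a set \<Rightarrow> 'a set" where
  "cut_add A B = {q_add a b |a b. a \<in> A \<and> b \<in> B}"

definition cut_neg :: "'a::mk_universe \<Rightarrow> 'a set \<Rightarrow> 'a set" where
  "cut_neg l A = {q \<in> surrats_below l. \<exists>r \<in> surrats_below l - A. q_less q (q_neg r)}"

definition cut_mul_nonneg :: "'a::mk_universe \<Rightarrow> 'a set \<Rightarrow> 'a set \<Rightarrow> 'a set" where
  "cut_mul_nonneg l A B = cut_zero l \<union>
     {q_mul a b |a b. a \<in> A \<and> b \<in> B \<and> q_le q_zero a \<and> q_le q_zero b}"

definition cut_mul :: "'a::mk_universe \<Rightarrow> 'a set \<Rightarrow> 'a set \<Rightarrow> 'a set" where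
  "cut_mul l A B =
    (if cut_zero l \<subseteq> A then
       if cut_zero l \<subseteq> B then cut_mul_nonneg l A B
       else cut_neg l (cut_mul_nonneg l A (cut_neg l B))
     else
       if cut_zero l \<subseteq> B then cut_neg l (cut_mul_nonneg l (cut_neg l A) B)
       else cut_mul_nonneg l (cut_neg l A) (cut_neg l B))"

definition cut_inv_pos :: "'a::mk_universe \<Rightarrow> 'a set \<Rightarrow> 'a set" where
  "cut_inv_pos l A = {q \<in> surrats_below l. \<exists>r \<in> surrats_below l - A. q_less q (q_inv r)}"

definition cut_inv :: "'a::mk_universe \<Rightarrow> 'a set \<Rightarrow> 'a set" where
  "cut_inv l A = (if cut_zero l \<subset> A then cut_inv_pos l A
                  else cut_neg l (cut_inv_pos l (cut_neg l A)))"

text \<open>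
  The components of the structure are graphs restricted to \<open>real_set l\<close>: negation is undefined
  at the empty cut (whose negative would be all of \<open>surrats_below l\<close>), and so are products whose
  value would be all of \<open>surrats_below l\<close>. Inversion is undefined at the zero cut.
\<close>

definition real_le :: "'a::mk_universe \<Rightarrow> 'a" where
  "real_le l = set_of {kpair L M |L M. L \<in> elts (real_set l) \<and> M \<in> elts (real_set l) \<and>
     elts L \<subseteq> elts M}"

definition real_add :: "'a::mk_universe \<Rightarrow> 'a" where
  "real_add l = set_of {kpair (kpair L M) N |L M N.
     L \<in> elts (real_set l) \<and> M \<in> elts (real_set l) \<and> N \<in> elts (real_set l) \<and>
     elts N = cut_add (elts L) (elts M)}"

definition real_neg :: "'a::mk_universe \<Rightarrow> 'a" where
  "real_neg l = set_of {kpair L M |L M. L \<in> elts (real_set l) \<and> M \<in> elts (real_set l) \<and>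
     elts M = cut_neg l (elts L)}"

definition real_mul :: "'a::mk_universe \<Rightarrow> 'a" where
  "real_mul l = set_of {kpair (kpair L M) N |L M N.
     L \<in> elts (real_set l) \<and> M \<in> elts (real_set l) \<and> N \<in> elts (real_set l) \<and>
     elts N = cut_mul l (elts L) (elts M)}"

definition real_inv :: "'a::mk_universe \<Rightarrow> 'a" where
  "real_inv l = set_of {kpair L M |L M. L \<in> elts (real_set l) \<and> M \<in> elts (real_set l) \<and>
     elts L \<noteq> cut_zero l \<and> elts M = cut_inv l (elts L)}"

definition tuple8 :: "'a::mk_universe \<Rightarrow> 'a \<Rightarrow> 'a \<Rightarrow> 'a \<Rightarrow> 'a \<Rightarrow> 'a \<Rightarrow> 'a \<Rightarrow> 'a \<Rightarrow> 'a" where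
  "tuple8 a b c d e f g h =
     kpair a (kpair b (kpair c (kpair d (kpair e (kpair f (kpair g h))))))"

definition real_struct :: "'a::mk_universe \<Rightarrow> 'a" where
  "real_struct l = tuple8 (real_set l) (real_le l) (real_add l) (real_neg l) (real_mul l)
     (real_inv l) (set_of (cut_zero l)) (set_of (cut_one l))"

end

theory Submission
  imports Defs
begin

text \<open>
  For an ordinal \<open>\<delta>\<close> and a times-number \<open>\<lambda>\<close> above \<open>\<omega>\<^sup>\<delta>\<^sup>+\<^sup>1\<close>, the fractions \<open>a / b\<close> below \<open>\<lambda>\<close> that are
  nonpositive or of degree at most \<open>\<delta>\<close> form a cut: comparing leading terms shows that they lie
  below all other fractions, and \<open>\<omega>\<^sup>\<delta> \<cdot> n\<close> for large \<open>n\<close> exceeds any given one of them. This needs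
  neither unique reduced fractions nor density of the Surrationals. As times-numbers are unbounded,
  every \<open>\<omega>\<^sup>\<delta>\<close> occurs at a fixed depth inside some \<open>\<real>\<^sub>\<lambda>\<close>. If the \<open>\<real>\<^sub>\<lambda>\<close> formed a set, then by union and
  replacement so would the ordinals.
\<close>

section \<open>Sets and ordinals\<close>

text \<open>\<open>cnf_coeff\<close> and \<open>ord_of_coeffs\<close> are definite descriptions, so
  nothing about natural sums, products or the order of Surintegers can be computed before Cantor
  normal forms are known to exist and to be unique. Hence the long preparation: ordinals under
  membership are matched with finitely supported coefficient functions under lexicographic
  comparison, and afterwards sums, products and comparisons are read off from coefficients. The
  principal cut at omega^\<delta> would be the obvious candidate, but it would require chaining
  comparisons of fractions and interpolating between them. The cut used instead sits in a gap
  between degrees: membership depends only on leading exponents and one sign, and the leading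
  exponent of a product is the natural sum of the leading exponents of its factors.
  Cross-multiplication then reduces every comparison to one of ordinals, except when the degrees
  coincide, where integer coefficients decide.\<close>

lemma elts_set_of: "is_set X \<Longrightarrow> elts (set_of X) = X"
  unfolding is_set_def set_of_def by (metis (mono_tags, lifting) mk_extensionality the_equality)

lemma is_set_elts [simp]: "is_set (elts x)"
  by (auto simp: is_set_def)

lemma is_set_mono: "is_set Y \<Longrightarrow> X \<subseteq> Y \<Longrightarrow> is_set X"
  unfolding is_set_def using mk_subset by metis

lemma is_set_pair [simp]: "is_set {x, y}"
  using mk_pairing by (auto simp: is_set_def)

lemma is_set_singleton [simp]: "is_set {x}"
  using is_set_pair[of x x] by simp

lemma is_set_empty [simp]: "is_set {}"
  by (rule is_set_mono[OF is_set_singleton]) simp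

lemma is_set_image:
  fixes f :: "'a::mk_universe \<Rightarrow> 'a"
  assumes "is_set X"
  shows "is_set (f ` X)"
proof -
  obtain x where "elts x = X"
    using assms by (auto simp: is_set_def)
  then show ?thesis
    using mk_replacement[of f x] by (simp add: is_set_def)
qed

lemma is_set_UN:
  fixes F :: "'a::mk_universe \<Rightarrow> 'a set"
  assumes "is_set X" and "\<And>x. x \<in> X \<Longrightarrow> is_set (F x)"
  shows "is_set (\<Union>x\<in>X. F x)"
proof -
  obtain z where z: "elts z = (\<lambda>x. set_of (F x)) ` X"
    using is_set_image[OF assms(1)] unfolding is_set_def by blast
  obtain y where "elts y = (\<Union>w\<in>elts z. elts w)"
    using mk_union by blast
  also have "\<dots> = (\<Union>x\<in>X. F x)"
    using z assms(2) by (simp add: elts_set_of)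
  finally show ?thesis
    by (auto simp: is_set_def)
qed

lemma is_set_Un [simp]:
  assumes "is_set X" "is_set Y"
  shows "is_set (X \<union> Y)"
proof -
  obtain x y where xy: "elts x = X" "elts y = Y"
    using assms by (auto simp: is_set_def)
  have "is_set (\<Union>z\<in>{x, y}. elts z)"
    by (rule is_set_UN) auto
  then show ?thesis
    using xy by simp
qed

lemma is_set_insert [simp]: "is_set X \<Longrightarrow> is_set (insert x X)"
  using is_set_Un[of "{x}" X] by simp

lemma kpair_eq_iff [simp]: "kpair x y = kpair x' y' \<longleftrightarrow> x = x' \<and> y = y'"
proof
  have e: "elts (kpair u v) = {set_of {u}, set_of {u, v}}" for u v :: 'a
    by (simp add: kpair_def elts_set_of)
  have inj: "is_set X \<Longrightarrow> is_set Y \<Longrightarrow> set_of X = set_of Y \<Longrightarrow> X = Y" for X Y :: "'a set"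
    by (metis elts_set_of)
  assume "kpair x y = kpair x' y'"
  then have "{set_of {x}, set_of {x, y}} = {set_of {x'}, set_of {x', y'}}"
    by (metis e)
  then show "x = x' \<and> y = y'"
    unfolding doubleton_eq_iff
    using inj[of "{x}" "{x'}"] inj[of "{x}" "{x', y'}"] inj[of "{x, y}" "{x'}"]
      inj[of "{x, y}" "{x', y'}"]
    by (auto simp: doubleton_eq_iff)
qed simp

lemma kfst_kpair [simp]: "kfst (kpair x y) = x"
  by (simp add: kfst_def)

lemma ksnd_kpair [simp]: "ksnd (kpair x y) = y"
  by (simp add: ksnd_def)

lemma is_set_kpairs:
  assumes "is_set X" "is_set Y"
  shows "is_set {kpair x y |x y. x \<in> X \<and> y \<in> Y}"
proof -
  have "{kpair x y |x y. x \<in> X \<and> y \<in> Y} = (\<Union>x\<in>X. kpair x ` Y)"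
    by auto
  then show ?thesis
    using assms by (simp add: is_set_UN is_set_image)
qed

lemma is_set_Pow:
  assumes "is_set X"
  shows "is_set {x. elts x \<subseteq> X}"
  using assms mk_power unfolding is_set_def by metis

section \<open>Membership induction and ordinals\<close>

lemma mem_induct:
  assumes "\<And>x :: 'a::mk_universe. (\<And>y. y \<in> elts x \<Longrightarrow> P y) \<Longrightarrow> P x"
  shows "P x"
  using wf_mem_rel by (induction x rule: wf_induct_rule) (auto simp: mem_rel_def intro: assms)

lemma mem_irrefl [simp]: "x \<notin> elts x"
  using wf_mem_rel by (metis case_prodI mem_Collect_eq mem_rel_def wf_irrefl)

lemma mem_asym: "x \<in> elts y \<Longrightarrow> y \<notin> elts x"
  using wf_asym[OF wf_mem_rel, of x y] by (auto simp: mem_rel_def)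

lemma is_ord_mem: "is_ord x \<Longrightarrow> y \<in> elts x \<Longrightarrow> is_ord y"
  unfolding is_ord_def by blast

lemma is_ord_trans: "is_ord z \<Longrightarrow> x \<in> elts y \<Longrightarrow> y \<in> elts z \<Longrightarrow> x \<in> elts z"
  unfolding is_ord_def by blast

lemma is_ord_subset: "is_ord x \<Longrightarrow> y \<in> elts x \<Longrightarrow> elts y \<subseteq> elts x"
  unfolding is_ord_def by blast

lemma is_ordI:
  "(\<And>y. y \<in> elts x \<Longrightarrow> is_ord y) \<Longrightarrow> (\<And>y. y \<in> elts x \<Longrightarrow> elts y \<subseteq> elts x) \<Longrightarrow> is_ord x"
  unfolding is_ord_def by blast

text \<open>Double induction: \<open>x\<close> is comparable with the elements of \<open>y\<close>,
  and the elements of \<open>x\<close> are comparable with \<open>y\<close>. If \<open>x\<close> and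
  \<open>y\<close> were incomparable, transitivity would make each a subset of the other, hence
  equal.\<close>

lemma is_ord_linear:
  assumes "is_ord x" "is_ord y"
  shows "x \<in> elts y \<or> x = y \<or> y \<in> elts x"
  using assms
proof (induction x arbitrary: y rule: mem_induct)
  case (1 x)
  note IHx = "1.IH" and ox = "1.prems"(1)
  show ?case
    using "1.prems"(2)
  proof (induction y rule: mem_induct)
    case (1 y)
    show ?case
    proof (rule ccontr)
      assume neg: "\<not> ?thesis"
      have "elts x \<subseteq> elts y"
      proof
        fix z assume z: "z \<in> elts x"
        then have "z \<in> elts y \<or> z = y \<or> y \<in> elts z"
          using IHx[OF z] is_ord_mem[OF ox z] "1.prems" by blast
        then show "z \<in> elts y"
          using neg z is_ord_trans[OF ox] by blast
      qed
      moreover have "elts y \<subseteq> elts x"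
      proof
        fix z assume z: "z \<in> elts y"
        then have "x \<in> elts z \<or> x = z \<or> z \<in> elts x"
          using "1.IH"[OF z] is_ord_mem[OF "1.prems" z] by blast
        then show "z \<in> elts x"
          using neg z is_ord_trans[OF "1.prems"] by blast
      qed
      ultimately have "x = y"
        using mk_extensionality by blast
      with neg show False by blast
    qed
  qed
qed

lemma ord_subset_iff:
  assumes "is_ord x" "is_ord y"
  shows "elts x \<subseteq> elts y \<longleftrightarrow> x = y \<or> x \<in> elts y"
  using is_ord_linear[OF assms] is_ord_subset[OF assms(2)] mem_irrefl by blast

lemma ord_subset_mem_trans:
  assumes "is_ord x" "is_ord z" "elts x \<subseteq> elts y" "y \<in> elts z"
  shows "x \<in> elts z"
  using assms ord_subset_iff[of x y] is_ord_mem is_ord_trans by blast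

text \<open>Source of the largest exponent in a finite support.\<close>

lemma ord_finite_max:
  assumes "finite X" "X \<noteq> {}" "\<And>x. x \<in> X \<Longrightarrow> is_ord x"
  shows "\<exists>m\<in>X. \<forall>x\<in>X. x = m \<or> x \<in> elts m"
  using assms
proof (induction rule: finite_ne_induct)
  case (singleton a)
  then show ?case by blast
next
  case (insert a X)
  then obtain m where m: "m \<in> X" "\<forall>x\<in>X. x = m \<or> x \<in> elts m"
    by blast
  then have a: "is_ord a" and "is_ord m"
    using insert.prems by blast+
  then consider "a = m \<or> a \<in> elts m" | "m \<in> elts a"
    using is_ord_linear by blast
  then show ?case
  proof cases
    case 1
    then show ?thesis
      using m by blast
  next
    case 2
    then have "\<forall>x\<in>insert a X. x = a \<or> x \<in> elts a"
      using m(2) is_ord_trans[OF a _ 2] by auto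
    then show ?thesis
      by blast
  qed
qed

section \<open>Finite ordinals, \<open>omega\<close>, and bounds for sets of ordinals\<close>

declare nat_ord.simps [simp del]

lemma is_ord_zero [simp]: "is_ord (nat_ord 0)" and elts_zero [simp]: "elts (nat_ord 0) = {}"
  by (simp_all add: nat_ord.simps(1) elts_set_of is_ord_def)

lemma elts_eq_empty_iff [simp]: "elts x = {} \<longleftrightarrow> x = nat_ord 0"
proof
  assume "elts x = {}"
  then show "x = nat_ord 0"
    by (intro mk_extensionality) simp
qed simp

definition osuc :: "'a::mk_universe \<Rightarrow> 'a" where
  "osuc x = set_of (insert x (elts x))"

lemma elts_osuc [simp]: "elts (osuc x) = insert x (elts x)"
  by (simp add: osuc_def elts_set_of)

lemma is_ord_osuc: "is_ord x \<Longrightarrow> is_ord (osuc x)"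
  by (auto simp: is_ord_def)

lemma nat_ord_Suc [simp]: "nat_ord (Suc n) = osuc (nat_ord n)"
  by (simp add: nat_ord.simps osuc_def)

lemma is_ord_nat_ord [simp]: "is_ord (nat_ord n)"
  by (induction n) (auto simp: is_ord_osuc)

lemma nat_ord_mem: "m < n \<Longrightarrow> nat_ord m \<in> elts (nat_ord n)"
  by (induction n) (auto simp: less_Suc_eq)

lemma inj_nat_ord: "inj nat_ord"
  by (metis injI linorder_neqE_nat mem_irrefl nat_ord_mem)

text \<open>The axiom of infinity gives only some inductive set; induction on \<open>n\<close> puts
  every finite ordinal into it.\<close>

lemma is_set_range_nat_ord: "is_set (range nat_ord :: 'a::mk_universe set)"
proof -
  obtain x :: 'a where e: "\<exists>e\<in>elts x. elts e = {}"
    and s: "\<forall>y\<in>elts x. \<exists>z\<in>elts x. elts z = insert y (elts y)"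
    using mk_infinity by blast
  have "nat_ord n \<in> elts x" for n
  proof (induction n)
    case 0
    then show ?case using e by auto
  next
    case (Suc n)
    then obtain z where "z \<in> elts x" "elts z = elts (osuc (nat_ord n))"
      using s by auto
    then show ?case
      using mk_extensionality[of z "osuc (nat_ord n)"] by auto
  qed
  then show ?thesis
    by (intro is_set_mono[OF is_set_elts[of x]]) auto
qed

lemma elts_omega: "elts omega = range nat_ord"
  by (simp add: omega_def elts_set_of is_set_range_nat_ord)

text \<open>Replacement concerns functions on sets, so a sequence indexed by HOL naturals is read as
  a function on \<open>omega\<close> through the inverse of \<open>nat_ord\<close>.\<close>

lemma is_set_range:
  fixes f :: "nat \<Rightarrow> 'a::mk_universe"
  shows "is_set (range f)"
proof -
  have "range f = (\<lambda>x. f (inv nat_ord x)) ` (range nat_ord :: 'a set)"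
    by (simp add: image_image inj_nat_ord)
  then show ?thesis
    using is_set_image[OF is_set_range_nat_ord] by simp
qed

lemma is_ord_Union:
  assumes "is_set X" "\<And>x. x \<in> X \<Longrightarrow> is_ord x"
  shows "is_ord (set_of (\<Union>x\<in>X. elts x))" "elts (set_of (\<Union>x\<in>X. elts x)) = (\<Union>x\<in>X. elts x)"
proof -
  show e: "elts (set_of (\<Union>x\<in>X. elts x)) = (\<Union>x\<in>X. elts x)"
    by (intro elts_set_of is_set_UN assms is_set_elts)
  show "is_ord (set_of (\<Union>x\<in>X. elts x))"
  proof (rule is_ordI)
    fix y assume "y \<in> elts (set_of (\<Union>x\<in>X. elts x))"
    then obtain x where x: "x \<in> X" "y \<in> elts x"
      unfolding e by blast
    show "is_ord y"
      using x is_ord_mem assms(2) by blast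
    show "elts y \<subseteq> elts (set_of (\<Union>x\<in>X. elts x))"
      unfolding e using x is_ord_subset assms(2) by blast
  qed
qed

text \<open>Taking successors first makes the union a strict bound even if \<open>X\<close> has a
  maximum.\<close>

lemma ex_ord_above:
  assumes "is_set X" "\<And>x. x \<in> X \<Longrightarrow> is_ord x"
  shows "\<exists>y. is_ord y \<and> X \<subseteq> elts y"
proof -
  have *: "is_set (osuc ` X)" "\<And>x. x \<in> osuc ` X \<Longrightarrow> is_ord x"
    using assms by (auto simp: is_set_image is_ord_osuc)
  show ?thesis
    using is_ord_Union[OF *] by fastforce
qed

text \<open>Burali-Forti: an ordinal above all ordinals would be an element of itself.\<close>

lemma proper_class_ords: "\<not> is_set {x :: 'a::mk_universe. is_ord x}"
  using ex_ord_above[of "{x :: 'a. is_ord x}"] mem_irrefl by blast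


section \<open>Ordinal arithmetic and Cantor normal forms\<close>

lemma elts_oadd: "elts (oadd a b) = elts a \<union> oadd a ` elts b"
  by (subst oadd.simps) (simp add: elts_set_of is_set_image)

lemma is_ord_oadd:
  assumes "is_ord a" "is_ord b"
  shows "is_ord (oadd a b)"
  using assms(2)
proof (induction b rule: mem_induct)
  case (1 b)
  show ?case
  proof (rule is_ordI)
    fix y assume y: "y \<in> elts (oadd a b)"
    show "is_ord y"
      using y 1 assms(1) is_ord_mem by (auto simp: elts_oadd)
    show "elts y \<subseteq> elts (oadd a b)"
      using y 1 assms(1) is_ord_subset by (fastforce simp: elts_oadd)
  qed
qed

lemma oadd_zero_right [simp]: "oadd a (nat_ord 0) = a"
  by (rule mk_extensionality) (simp add: elts_oadd)

lemma oadd_zero_left [simp]: "oadd (nat_ord 0) b = b"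
proof (induction b rule: mem_induct)
  case (1 b)
  then show ?case
    by (intro mk_extensionality) (auto simp: elts_oadd)
qed

lemma oadd_mono_right: "b \<in> elts c \<Longrightarrow> oadd a b \<in> elts (oadd a c)"
  by (auto simp: elts_oadd)

lemma elts_omul: "elts (omul a b) = (\<Union>c\<in>elts b. elts (oadd (omul a c) a))"
  by (subst omul.simps) (simp add: elts_set_of is_set_UN)

lemma omul_zero [simp]: "omul a (nat_ord 0) = nat_ord 0"
  by (rule mk_extensionality) (simp add: elts_omul)

lemma omul_osuc: "omul a (osuc b) = oadd (omul a b) a"
  by (rule mk_extensionality) (auto simp: elts_omul[of a "osuc b"] elts_omul[of a b] elts_oadd)

lemma is_ord_omul_nat: "is_ord a \<Longrightarrow> is_ord (omul a (nat_ord n))"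
  by (induction n) (auto simp: omul_osuc is_ord_oadd)

lemma omul_nat_mono: "m \<le> n \<Longrightarrow> elts (omul a (nat_ord m)) \<subseteq> elts (omul a (nat_ord n))"
  by (induction n) (auto simp: omul_osuc le_Suc_eq elts_oadd)

lemma elts_omul_omega: "elts (omul a omega) = (\<Union>n. elts (omul a (nat_ord (Suc n))))"
  by (simp add: elts_omul elts_omega omul_osuc)

text \<open>Multiplication by \<open>omega\<close> is dissolved into finite multiples, so that a
  nonzero ordinal below a power lies below a finite multiple of a smaller power. Descent on
  exponents needs this form.\<close>

lemma elts_omega_pow:
  "elts (omega_pow b) = insert (nat_ord 0) (\<Union>c\<in>elts b. \<Union>n. elts (omul (omega_pow c) (nat_ord (Suc n))))"
proof -
  have "elts (omega_pow b) = insert (nat_ord 0) (\<Union>c\<in>elts b. elts (omul (omega_pow c) omega))"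
    by (subst omega_pow.simps) (simp add: elts_set_of is_set_UN nat_ord.simps(1))
  then show ?thesis
    by (simp add: elts_omul_omega)
qed

lemma is_ord_omega_pow:
  assumes "is_ord b"
  shows "is_ord (omega_pow b)"
  using assms
proof (induction b rule: mem_induct)
  case (1 b)
  have o: "is_ord (omul (omega_pow c) (nat_ord n))" if "c \<in> elts b" for c n
    using 1 that is_ord_mem is_ord_omul_nat by blast
  show ?case
  proof (rule is_ordI)
    fix y assume "y \<in> elts (omega_pow b)"
    then consider "y = nat_ord 0" | c n where "c \<in> elts b" "y \<in> elts (omul (omega_pow c) (nat_ord (Suc n)))"
      unfolding elts_omega_pow[of b] by blast
    then have "is_ord y \<and> elts y \<subseteq> elts (omega_pow b)"
    proof cases
      case 2
      have "elts (omul (omega_pow c) (nat_ord (Suc n))) \<subseteq> elts (omega_pow b)"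
        using 2(1) unfolding elts_omega_pow[of b] by blast
      then show ?thesis
        using is_ord_mem[OF o[OF 2(1)] 2(2)] is_ord_subset[OF o[OF 2(1)] 2(2)] by blast
    qed simp
    then show "is_ord y" "elts y \<subseteq> elts (omega_pow b)"
      by blast+
  qed
qed

abbreviation cterm :: "'a::mk_universe \<Rightarrow> nat \<Rightarrow> 'a" where
  "cterm \<zeta> c \<equiv> omul (omega_pow \<zeta>) (nat_ord c)"

lemma is_ord_cterm: "is_ord \<zeta> \<Longrightarrow> is_ord (cterm \<zeta> c)"
  by (simp add: is_ord_omul_nat is_ord_omega_pow)

lemma cterm_Suc: "cterm \<zeta> (Suc c) = oadd (cterm \<zeta> c) (omega_pow \<zeta>)"
  by (simp add: omul_osuc)

text \<open>A remainder below omega^\<zeta> keeps the sum below the next multiple, omega^\<zeta> (c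
  + 1), which is at most omega^\<zeta> d.\<close>

lemma cterm_add_less:
  "r \<in> elts (omega_pow \<zeta>) \<Longrightarrow> c < d \<Longrightarrow> oadd (cterm \<zeta> c) r \<in> elts (cterm \<zeta> d)"
  using omul_nat_mono[of "Suc c" d "omega_pow \<zeta>"] oadd_mono_right cterm_Suc
  by (metis Suc_leI subsetD)

lemma zero_mem_omega_pow: "nat_ord 0 \<in> elts (omega_pow \<zeta>)"
  by (simp add: elts_omega_pow)

lemma cterm_less_omega_pow:
  assumes "\<zeta> \<in> elts \<eta>" "r \<in> elts (omega_pow \<zeta>)"
  shows "oadd (cterm \<zeta> c) r \<in> elts (omega_pow \<eta>)"
  using cterm_add_less[OF assms(2), of c "Suc c"] assms(1) by (fastforce simp: elts_omega_pow[of \<eta>])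

lemma cterm_ge: "0 < c \<Longrightarrow> elts (omega_pow \<zeta>) \<subseteq> elts (cterm \<zeta> c)"
  using omul_nat_mono[of 1 c "omega_pow \<zeta>"] by (simp add: omul_osuc)

text \<open>For y in x, y \<le> omega^y < omega^x. Applied to the successor of \<alpha>, this puts
  \<alpha> below a power of omega, where normal forms are found by induction on the
  exponent.\<close>

lemma self_le_omega_pow:
  assumes "is_ord x"
  shows "elts x \<subseteq> elts (omega_pow x)"
  using assms
proof (induction x rule: mem_induct)
  case (1 x)
  show ?case
  proof
    fix y assume y: "y \<in> elts x"
    have "omega_pow y \<in> elts (omega_pow x)"
      using cterm_less_omega_pow[OF y zero_mem_omega_pow, of 1] by (simp add: omul_osuc)
    then show "y \<in> elts (omega_pow x)"
      using 1 y is_ord_mem ord_subset_mem_trans is_ord_omega_pow by metis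
  qed
qed

section \<open>Normal forms as lists, and their existence\<close>

definition cnf_list :: "('a::mk_universe \<times> nat) list \<Rightarrow> bool" where
  "cnf_list xs \<longleftrightarrow> sorted_wrt (\<lambda>x y. fst y \<in> elts (fst x)) xs \<and> (\<forall>(\<zeta>, c)\<in>set xs. is_ord \<zeta> \<and> 0 < c)"

text \<open>What \<open>cnf_coeff\<close> reads off, but for a given list: no description operator
  intervenes before uniqueness is known.\<close>

definition list_coeff :: "('a \<times> nat) list \<Rightarrow> 'a \<Rightarrow> nat" where
  "list_coeff xs \<zeta> = (case map_of xs \<zeta> of None \<Rightarrow> 0 | Some c \<Rightarrow> c)"

lemma is_cnf_iff: "is_cnf xs \<alpha> \<longleftrightarrow> cnf_list xs \<and> cnf_value xs = \<alpha>"
  by (auto simp: is_cnf_def cnf_list_def)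

lemma cnf_list_Nil [simp]: "cnf_list []"
  by (simp add: cnf_list_def)

lemma cnf_list_Cons:
  "cnf_list ((\<zeta>, c) # xs) \<longleftrightarrow> is_ord \<zeta> \<and> 0 < c \<and> cnf_list xs \<and> (\<forall>x\<in>set xs. fst x \<in> elts \<zeta>)"
  by (auto simp: cnf_list_def)

lemma cnf_value_Nil [simp]: "cnf_value [] = nat_ord 0"
  by (simp add: cnf_value_def)

lemma cnf_value_Cons [simp]: "cnf_value ((\<zeta>, c) # xs) = oadd (cterm \<zeta> c) (cnf_value xs)"
  by (simp add: cnf_value_def)

lemma list_coeff_Nil [simp]: "list_coeff [] \<zeta> = 0"
  by (simp add: list_coeff_def)

lemma list_coeff_Cons [simp]: "list_coeff ((\<eta>, c) # xs) \<zeta> = (if \<zeta> = \<eta> then c else list_coeff xs \<zeta>)"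
  by (simp add: list_coeff_def)

lemma list_coeff_nonzero: "list_coeff xs \<zeta> \<noteq> 0 \<Longrightarrow> \<zeta> \<in> fst ` set xs"
  by (induction xs) (auto split: if_splits)

lemma is_ord_cnf_value: "cnf_list xs \<Longrightarrow> is_ord (cnf_value xs)"
  by (induction xs) (auto simp: cnf_list_Cons is_ord_oadd is_ord_cterm)

lemma cnf_value_bound:
  "cnf_list xs \<Longrightarrow> (\<And>x. x \<in> set xs \<Longrightarrow> fst x \<in> elts \<eta>) \<Longrightarrow> cnf_value xs \<in> elts (omega_pow \<eta>)"
proof (induction xs arbitrary: \<eta>)
  case Nil
  then show ?case
    by (simp add: zero_mem_omega_pow)
next
  case (Cons x xs)
  obtain \<zeta> c where x: "x = (\<zeta>, c)"
    by force
  have "cnf_value xs \<in> elts (omega_pow \<zeta>)"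
    using Cons by (auto simp: x cnf_list_Cons)
  then show ?case
    using Cons.prems(2)[of x] by (simp add: x cterm_less_omega_pow)
qed

text \<open>Division with remainder: going through the multiples of omega^\<gamma>, \<alpha> is
  either below the previous multiple or equal to omega^\<gamma> n + r with r < omega^\<gamma>, and r
  is treated at the smaller exponent \<gamma>. The bound on exponents is carried along so that the
  term for \<gamma> can be put in front.\<close>

lemma ex_cnf_below_omega_pow:
  assumes "\<alpha> \<in> elts (omega_pow \<eta>)" "is_ord \<eta>"
  shows "\<exists>xs. cnf_list xs \<and> cnf_value xs = \<alpha> \<and> (\<forall>x\<in>set xs. fst x \<in> elts \<eta>)"
  using assms
proof (induction \<eta> arbitrary: \<alpha> rule: mem_induct)
  case (1 \<eta>)
  show ?case
  proof (cases "\<alpha> = nat_ord 0")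
    case True
    then show ?thesis
      by (intro exI[of _ "[]"]) simp
  next
    case False
    then obtain \<gamma> n where \<gamma>: "\<gamma> \<in> elts \<eta>" "\<alpha> \<in> elts (cterm \<gamma> n)"
      using "1.prems" unfolding elts_omega_pow[of \<eta>] by blast
    from \<gamma>(2) show ?thesis
    proof (induction n)
      case (Suc n)
      show ?case
      proof (cases "\<alpha> \<in> elts (cterm \<gamma> n)")
        case False
        then obtain r where r: "r \<in> elts (omega_pow \<gamma>)" "\<alpha> = oadd (cterm \<gamma> n) r"
          using Suc.prems by (auto simp: omul_osuc elts_oadd)
        obtain xs where xs: "cnf_list xs" "cnf_value xs = r" "\<forall>x\<in>set xs. fst x \<in> elts \<gamma>"
          using "1.IH"[OF \<gamma>(1) r(1)] is_ord_mem[OF "1.prems"(2) \<gamma>(1)] by blast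
        have lt: "\<forall>x\<in>set xs. fst x \<in> elts \<eta>"
          using xs(3) is_ord_trans[OF "1.prems"(2) _ \<gamma>(1)] by blast
        show ?thesis
        \<comment> \<open>Normal forms admit no zero coefficient, so for \<open>n = 0\<close> the
          term is left out.\<close>
        proof (cases "n = 0")
          case True
          then show ?thesis
            using xs r lt by (intro exI[of _ xs]) simp
        next
          case False
          then show ?thesis
            using xs r lt \<gamma>(1) is_ord_mem[OF "1.prems"(2) \<gamma>(1)]
            by (intro exI[of _ "(\<gamma>, n) # xs"]) (auto simp: cnf_list_Cons)
        qed
      qed (rule Suc.IH)
    qed simp
  qed
qed

lemma ex_cnf:
  assumes "is_ord \<alpha>"
  shows "\<exists>xs. cnf_list xs \<and> cnf_value xs = \<alpha>"
proof -
  have "\<alpha> \<in> elts (omega_pow (osuc \<alpha>))"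
    using self_le_omega_pow[OF is_ord_osuc[OF assms]] by auto
  then show ?thesis
    using ex_cnf_below_omega_pow is_ord_osuc[OF assms] by blast
qed

section \<open>Lexicographic comparison of coefficients and of values\<close>

definition lex_less :: "('a::mk_universe \<Rightarrow> 'b::linorder) \<Rightarrow> ('a \<Rightarrow> 'b) \<Rightarrow> bool" where
  "lex_less f g \<longleftrightarrow> (\<exists>\<zeta>. is_ord \<zeta> \<and> f \<zeta> < g \<zeta> \<and> (\<forall>\<eta>. is_ord \<eta> \<and> \<zeta> \<in> elts \<eta> \<longrightarrow> f \<eta> = g \<eta>))"

lemma lex_less_asym: "lex_less f g \<Longrightarrow> \<not> lex_less g f"
  unfolding lex_less_def by (metis is_ord_linear less_irrefl less_asym)

text \<open>A power of omega exceeds every normal form with smaller exponents. So the heads decide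
  unless they agree, and then the tails inherit the difference.\<close>

lemma cnf_value_less:
  "cnf_list xs \<Longrightarrow> cnf_list ys \<Longrightarrow> lex_less (list_coeff xs) (list_coeff ys) \<Longrightarrow>
    cnf_value xs \<in> elts (cnf_value ys)"
proof (induction xs arbitrary: ys)
  case Nil
  then obtain \<beta> d ys' where ys: "ys = (\<beta>, d) # ys'"
    by (cases ys) (auto simp: lex_less_def)
  then show ?case
    using Nil.prems cterm_ge[of d \<beta>] zero_mem_omega_pow[of \<beta>]
    by (auto simp: cnf_list_Cons elts_oadd)
next
  case (Cons x xs)
  obtain \<alpha> c where x: "x = (\<alpha>, c)"
    by force
  obtain \<beta> d ys' where ys: "ys = (\<beta>, d) # ys'"
    using Cons.prems(3) by (cases ys) (auto simp: lex_less_def)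
  have X: "is_ord \<alpha>" "0 < c" "cnf_list xs" "\<And>z. z \<in> set xs \<Longrightarrow> fst z \<in> elts \<alpha>"
    using Cons.prems by (auto simp: x cnf_list_Cons)
  have Y: "is_ord \<beta>" "0 < d" "cnf_list ys'" "\<And>z. z \<in> set ys' \<Longrightarrow> fst z \<in> elts \<beta>"
    using Cons.prems by (auto simp: ys cnf_list_Cons)
  obtain \<zeta> where z: "is_ord \<zeta>" "list_coeff (x # xs) \<zeta> < list_coeff ys \<zeta>"
    "\<And>\<eta>. is_ord \<eta> \<Longrightarrow> \<zeta> \<in> elts \<eta> \<Longrightarrow> list_coeff (x # xs) \<eta> = list_coeff ys \<eta>"
    using Cons.prems(3) by (auto simp: lex_less_def)
  have zb: "\<zeta> = \<beta> \<or> \<zeta> \<in> elts \<beta>"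
    using z(2) list_coeff_nonzero[of ys \<zeta>] Y(4) by (auto simp: ys)
  have zero: "list_coeff ys' \<eta> = 0" if "\<beta> \<in> elts \<eta> \<or> \<eta> = \<beta>" for \<eta>
    using list_coeff_nonzero[of ys' \<eta>] Y(4) that mem_asym mem_irrefl by fastforce
  have zero': "list_coeff xs \<alpha> = 0"
    using list_coeff_nonzero[of xs \<alpha>] X(4) mem_irrefl by fastforce
  have vx: "cnf_value xs \<in> elts (omega_pow \<alpha>)"
    by (rule cnf_value_bound[OF X(3,4)])
  consider "\<alpha> \<in> elts \<beta>" | "\<beta> \<in> elts \<alpha>" | "\<alpha> = \<beta>"
    using is_ord_linear X(1) Y(1) by blast
  then show ?case
  proof cases
    case 1
    have "cnf_value (x # xs) \<in> elts (omega_pow \<beta>)"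
      using cterm_less_omega_pow[OF 1 vx] by (simp add: x)
    then show ?thesis
      using cterm_ge[OF Y(2), of \<beta>] by (auto simp: ys elts_oadd)
  next
    \<comment> \<open>Impossible: coefficients agree above \<zeta>, so the positive head coefficient
      \<open>c\<close> would occur in \<open>ys\<close> at an exponent beyond the head of
      \<open>ys\<close>.\<close>
    case 2
    then have "\<zeta> \<in> elts \<alpha>"
      using zb is_ord_trans[OF X(1)] by blast
    then have "c = list_coeff ys \<alpha>"
      using z(3)[OF X(1)] by (simp add: x)
    then show ?thesis
      using X(2) 2 zero[of \<alpha>] by (auto simp: ys split: if_splits)
  next
    case 3
    show ?thesis
    proof (cases "\<zeta> = \<alpha>")
      case True
      then have "c < d"
        using z(2) 3 by (simp add: x ys)
      then show ?thesis
        using cterm_add_less[OF vx] 3 by (auto simp: x ys elts_oadd)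
    next
      case False
      then have za: "\<zeta> \<in> elts \<alpha>"
        using zb 3 by blast
      then have cd: "c = d"
        using z(3)[OF X(1)] 3 by (simp add: x ys)
      \<comment> \<open>The witness remains \<zeta>: at the common head exponent both tails have
        coefficient 0, elsewhere they agree with the full lists.\<close>
      have "lex_less (list_coeff xs) (list_coeff ys')"
        unfolding lex_less_def
      proof (intro exI[of _ \<zeta>] conjI allI impI)
        show "list_coeff xs \<zeta> < list_coeff ys' \<zeta>"
          using z(2) False 3 by (simp add: x ys)
        fix \<eta> assume "is_ord \<eta> \<and> \<zeta> \<in> elts \<eta>"
        then show "list_coeff xs \<eta> = list_coeff ys' \<eta>"
          using z(3)[of \<eta>] zero[of \<eta>] zero' 3 by (auto simp: x ys split: if_splits)
      qed (rule z(1))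
      then have "cnf_value xs \<in> elts (cnf_value ys')"
        using Cons.IH X Y by blast
      then show ?thesis
        using 3 cd by (simp add: x ys oadd_mono_right)
    qed
  qed
qed

text \<open>Each head exponent has a nonzero coefficient in the other list as well, so neither head
  exponent exceeds the other.\<close>

lemma cnf_list_eqI:
  "cnf_list xs \<Longrightarrow> cnf_list ys \<Longrightarrow> list_coeff xs = list_coeff ys \<Longrightarrow> xs = ys"
proof (induction xs arbitrary: ys)
  case Nil
  then show ?case
    by (cases ys) (auto simp: fun_eq_iff cnf_list_Cons split: if_splits)
next
  case (Cons x xs)
  obtain \<alpha> c where x: "x = (\<alpha>, c)"
    by force
  have X: "is_ord \<alpha>" "0 < c" "cnf_list xs" "\<And>z. z \<in> set xs \<Longrightarrow> fst z \<in> elts \<alpha>"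
    using Cons.prems by (auto simp: x cnf_list_Cons)
  obtain \<beta> d ys' where ys: "ys = (\<beta>, d) # ys'"
    using Cons.prems(3) X(2) by (cases ys) (auto simp: fun_eq_iff x split: if_splits)
  have Y: "is_ord \<beta>" "0 < d" "cnf_list ys'" "\<And>z. z \<in> set ys' \<Longrightarrow> fst z \<in> elts \<beta>"
    using Cons.prems by (auto simp: ys cnf_list_Cons)
  have eq: "list_coeff (x # xs) \<eta> = list_coeff ys \<eta>" for \<eta>
    using Cons.prems(3) by simp
  have "\<alpha> = \<beta> \<or> \<alpha> \<in> elts \<beta>"
    using eq[of \<alpha>] X(2) list_coeff_nonzero[of ys' \<alpha>] Y(4) by (auto simp: x ys split: if_splits)
  moreover have "\<alpha> = \<beta> \<or> \<beta> \<in> elts \<alpha>"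
    using eq[of \<beta>] Y(2) list_coeff_nonzero[of xs \<beta>] X(4) by (auto simp: x ys split: if_splits)
  ultimately have ab: "\<alpha> = \<beta>"
    using mem_asym by blast
  have "list_coeff xs \<alpha> = 0" "list_coeff ys' \<alpha> = 0"
    using list_coeff_nonzero[of xs \<alpha>] X(4) list_coeff_nonzero[of ys' \<alpha>] Y(4) ab mem_irrefl
    by fastforce+
  then have "list_coeff xs = list_coeff ys'"
    using eq ab by (auto simp: fun_eq_iff x ys split: if_splits) metis
  then show ?case
    using Cons.IH X(3) Y(3) eq[of \<alpha>] ab by (auto simp: x ys)
qed


section \<open>Ordinals as coefficient functions of finite support\<close>

definition ord_supported :: "('a::mk_universe \<Rightarrow> 'b::zero) \<Rightarrow> bool" where
  "ord_supported f \<longleftrightarrow> finite {\<zeta>. f \<zeta> \<noteq> 0} \<and> (\<forall>\<zeta>. f \<zeta> \<noteq> 0 \<longrightarrow> is_ord \<zeta>)"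

text \<open>The largest exponent of disagreement decides. Finite support makes it exist; the ordinal
  condition makes it a legitimate witness, since coefficient functions are defined on all
  sets.\<close>

lemma lex_less_linear:
  fixes f g :: "'a::mk_universe \<Rightarrow> 'b::{linorder,zero}"
  assumes "ord_supported f" "ord_supported g" "f \<noteq> g"
  shows "lex_less f g \<or> lex_less g f"
proof -
  let ?D = "{\<zeta>. f \<zeta> \<noteq> g \<zeta>}"
  have sub: "?D \<subseteq> {\<zeta>. f \<zeta> \<noteq> 0} \<union> {\<zeta>. g \<zeta> \<noteq> 0}"
    by auto
  then have "finite ?D"
    using assms(1,2) by (auto simp: ord_supported_def intro: finite_subset)
  moreover have "?D \<noteq> {}"
    using assms(3) by auto
  moreover have ord: "\<zeta> \<in> ?D \<Longrightarrow> is_ord \<zeta>" for \<zeta>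
    using sub assms(1,2) by (auto simp: ord_supported_def)
  ultimately obtain m where m: "m \<in> ?D" "\<forall>\<zeta>\<in>?D. \<zeta> = m \<or> \<zeta> \<in> elts m"
    using ord_finite_max by meson
  have above: "f \<eta> = g \<eta>" if "m \<in> elts \<eta>" for \<eta>
  proof (rule ccontr)
    assume "f \<eta> \<noteq> g \<eta>"
    then have "\<eta> = m \<or> \<eta> \<in> elts m"
      using m(2) by simp
    then show False
      using mem_asym[OF that] that by auto
  qed
  have "f m < g m \<or> g m < f m"
    using m(1) by auto
  then show ?thesis
    using ord[OF m(1)] above unfolding lex_less_def by metis
qed

lemma ord_supported_list_coeff:
  assumes "cnf_list xs"
  shows "ord_supported (list_coeff xs)"
proof -
  have sub: "{\<zeta>. list_coeff xs \<zeta> \<noteq> 0} \<subseteq> fst ` set xs"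
    by (intro subsetI) (drule CollectD, rule list_coeff_nonzero)
  have "is_ord \<zeta>" if "\<zeta> \<in> fst ` set xs" for \<zeta>
    using that assms by (auto simp: cnf_list_def)
  then show ?thesis
    using sub finite_subset[OF sub finite_imageI[OF finite_set]] unfolding ord_supported_def by blast
qed

text \<open>The largest exponent becomes the head, and the rest of the function has a smaller
  support.\<close>

lemma ex_cnf_list_of_coeffs:
  assumes "ord_supported (f :: 'a::mk_universe \<Rightarrow> nat)"
  shows "\<exists>xs. cnf_list xs \<and> list_coeff xs = f"
  using assms
proof (induction "card {\<zeta>. f \<zeta> \<noteq> 0}" arbitrary: f rule: less_induct)
  case less
  let ?S = "{\<zeta>. f \<zeta> \<noteq> 0}"
  have fin: "finite ?S" and ord: "\<And>\<zeta>. \<zeta> \<in> ?S \<Longrightarrow> is_ord \<zeta>"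
    using less.prems by (auto simp: ord_supported_def)
  show ?case
  proof (cases "?S = {}")
    case True
    then show ?thesis
      by (intro exI[of _ "[]"]) auto
  next
    case False
    obtain m where m: "m \<in> ?S" "\<forall>\<zeta>\<in>?S. \<zeta> = m \<or> \<zeta> \<in> elts m"
      using ord_finite_max[OF fin False ord] by blast
    let ?g = "f(m := 0)"
    have S: "{\<zeta>. ?g \<zeta> \<noteq> 0} = ?S - {m}"
      by auto
    have "card {\<zeta>. ?g \<zeta> \<noteq> 0} < card ?S"
      unfolding S using fin m(1) by (rule card_Diff1_less)
    moreover have "ord_supported ?g"
      unfolding ord_supported_def S using fin ord by auto
    ultimately obtain xs where xs: "cnf_list xs" "list_coeff xs = ?g"
      using less.hyps by blast
    have "fst x \<in> elts m" if "x \<in> set xs" for x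
    proof -
      \<comment> \<open>Entries of a \<open>cnf_list\<close> are positive, so a listed exponent
        belongs to the support of \<open>?g\<close> and is therefore below \<open>m\<close>.\<close>
      have "list_coeff xs (fst x) \<noteq> 0"
      proof
        assume 0: "list_coeff xs (fst x) = 0"
        have "map_of xs (fst x) \<noteq> None"
          using that by (simp add: map_of_eq_None_iff)
        then obtain c where "map_of xs (fst x) = Some c"
          by blast
        then have "(fst x, c) \<in> set xs" "c = 0"
          using 0 map_of_SomeD by (auto simp: list_coeff_def)
        then show False
          using xs(1) by (auto simp: cnf_list_def)
      qed
      then show ?thesis
        using m(2) unfolding xs(2) by (auto split: if_splits)
    qed
    then have "cnf_list ((m, f m) # xs)"
      using m(1) ord[OF m(1)] xs(1) by (auto simp: cnf_list_Cons)
    moreover have "list_coeff ((m, f m) # xs) = f"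
      using xs(2) by auto
    ultimately show ?thesis
      by blast
  qed
qed

text \<open>Distinct normal forms have distinct coefficients, hence one value would be an element of
  the other; but no set is an element of itself. This makes the description in
  \<open>cnf_coeff\<close> denote.\<close>

lemma is_cnf_unique:
  assumes "is_cnf xs \<alpha>" "is_cnf ys \<alpha>"
  shows "xs = ys"
proof (rule ccontr)
  have xs: "cnf_list xs" and ys: "cnf_list ys" and eq: "cnf_value xs = cnf_value ys"
    using assms by (auto simp: is_cnf_iff)
  assume "xs \<noteq> ys"
  then have "list_coeff xs \<noteq> list_coeff ys"
    using cnf_list_eqI[OF xs ys] by blast
  then have "cnf_value xs \<in> elts (cnf_value ys) \<or> cnf_value ys \<in> elts (cnf_value xs)"
    using lex_less_linear ord_supported_list_coeff cnf_value_less xs ys by metis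
  then show False
    using eq by simp
qed

lemma cnf_coeff_cnf_value: "cnf_list xs \<Longrightarrow> cnf_coeff (cnf_value xs) = list_coeff xs"
proof -
  assume "cnf_list xs"
  then have "is_cnf xs (cnf_value xs)"
    by (simp add: is_cnf_iff)
  then have "(THE ys. is_cnf ys (cnf_value xs)) = xs"
    using is_cnf_unique by blast
  then show ?thesis
    by (simp add: cnf_coeff_def list_coeff_def fun_eq_iff)
qed

lemma ord_supported_cnf_coeff: "is_ord \<alpha> \<Longrightarrow> ord_supported (cnf_coeff \<alpha>)"
  using ex_cnf cnf_coeff_cnf_value ord_supported_list_coeff by metis

lemma lex_less_cnf_coeff:
  assumes "is_ord \<alpha>" "is_ord \<beta>" "lex_less (cnf_coeff \<alpha>) (cnf_coeff \<beta>)"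
  shows "\<alpha> \<in> elts \<beta>"
  using ex_cnf[OF assms(1)] ex_cnf[OF assms(2)] assms(3) cnf_coeff_cnf_value cnf_value_less by metis

lemma cnf_coeff_inject:
  assumes "is_ord \<alpha>" "is_ord \<beta>" "cnf_coeff \<alpha> = cnf_coeff \<beta>"
  shows "\<alpha> = \<beta>"
  using ex_cnf[OF assms(1)] ex_cnf[OF assms(2)] assms(3) cnf_coeff_cnf_value cnf_list_eqI by metis

text \<open>By linearity: the opposite comparison would give \<beta> \<in> \<alpha>, and equal
  coefficients would give \<alpha> = \<beta>.\<close>

lemma cnf_coeff_lex_less:
  assumes "is_ord \<beta>" "\<alpha> \<in> elts \<beta>"
  shows "lex_less (cnf_coeff \<alpha>) (cnf_coeff \<beta>)"
proof -
  have \<alpha>: "is_ord \<alpha>"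
    using assms is_ord_mem by blast
  have "cnf_coeff \<alpha> \<noteq> cnf_coeff \<beta>"
    using cnf_coeff_inject[OF \<alpha> assms(1)] assms(2) mem_irrefl by blast
  then show ?thesis
    using lex_less_linear[OF ord_supported_cnf_coeff[OF \<alpha>] ord_supported_cnf_coeff[OF assms(1)]]
      lex_less_cnf_coeff[OF assms(1) \<alpha>] mem_asym[OF assms(2)] by blast
qed

lemma ord_of_coeffs:
  assumes "ord_supported f"
  shows "is_ord (ord_of_coeffs f) \<and> cnf_coeff (ord_of_coeffs f) = f"
  unfolding ord_of_coeffs_def
proof (rule theI')
  obtain xs where "cnf_list xs" "list_coeff xs = f"
    using ex_cnf_list_of_coeffs[OF assms] by blast
  then show "\<exists>!\<alpha>. is_ord \<alpha> \<and> cnf_coeff \<alpha> = f"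
    using is_ord_cnf_value cnf_coeff_cnf_value cnf_coeff_inject by metis
qed

lemmas is_ord_ord_of_coeffs = ord_of_coeffs[THEN conjunct1]
  and cnf_coeff_ord_of_coeffs = ord_of_coeffs[THEN conjunct2]

lemma cnf_coeff_zero [simp]: "cnf_coeff (nat_ord 0 :: 'a::mk_universe) \<zeta> = 0"
  using cnf_coeff_cnf_value[of "[] :: ('a \<times> nat) list"] by simp

lemma cnf_coeff_cterm:
  assumes "is_ord \<delta>"
  shows "cnf_coeff (cterm \<delta> c) = (\<lambda>\<zeta>. if \<zeta> = \<delta> then c else 0)"
proof (cases "c = 0")
  case False
  then have "cnf_list [(\<delta>, c)]"
    using assms by (simp add: cnf_list_Cons)
  from cnf_coeff_cnf_value[OF this] show ?thesis
    by (simp add: fun_eq_iff)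
qed (simp add: fun_eq_iff)

lemma cterm_zero_one: "cterm (nat_ord 0) 1 = nat_ord 1"
proof (rule mk_extensionality)
  have "elts (cterm (nat_ord 0) 1) = elts (omega_pow (nat_ord 0))"
    by (simp add: omul_osuc)
  also have "\<dots> = {nat_ord 0}"
    unfolding elts_omega_pow[of "nat_ord 0"] by simp
  finally show "elts (cterm (nat_ord 0) 1) = elts (nat_ord 1)"
    by simp
qed

lemma cnf_coeff_one: "cnf_coeff (nat_ord 1) = (\<lambda>\<zeta>. if \<zeta> = nat_ord 0 then 1 else 0)"
  using cnf_coeff_cterm[OF is_ord_zero, of 1] by (simp only: cterm_zero_one)


section \<open>Natural sums and leading terms\<close>

lemma ord_supported_add:
  fixes f g :: "'a::mk_universe \<Rightarrow> 'b::monoid_add"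
  assumes "ord_supported f" "ord_supported g"
  shows "ord_supported (\<lambda>\<zeta>. f \<zeta> + g \<zeta>)"
proof -
  have sub: "{\<zeta>. f \<zeta> + g \<zeta> \<noteq> 0} \<subseteq> {\<zeta>. f \<zeta> \<noteq> 0} \<union> {\<zeta>. g \<zeta> \<noteq> 0}"
    by auto
  then have "finite {\<zeta>. f \<zeta> + g \<zeta> \<noteq> 0}"
    using assms by (auto simp: ord_supported_def intro: finite_subset)
  then show ?thesis
    using sub assms by (auto simp: ord_supported_def)
qed

text \<open>Through \<open>cnf_coeff_inject\<close>, associativity and the zero law become laws of
  pointwise addition of natural numbers.\<close>

lemma natural_sum:
  assumes "is_ord \<alpha>" "is_ord \<beta>"
  shows is_ord_natural_sum: "is_ord (natural_sum \<alpha> \<beta>)"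
    and cnf_coeff_natural_sum: "cnf_coeff (natural_sum \<alpha> \<beta>) = (\<lambda>\<zeta>. cnf_coeff \<alpha> \<zeta> + cnf_coeff \<beta> \<zeta>)"
  using ord_of_coeffs[OF ord_supported_add[OF assms[THEN ord_supported_cnf_coeff]]]
  unfolding natural_sum_def by auto

lemma natural_sum_comm: "natural_sum \<alpha> \<beta> = natural_sum \<beta> \<alpha>"
  unfolding natural_sum_def by (simp add: add.commute)

lemma natural_sum_assoc:
  assumes "is_ord \<alpha>" "is_ord \<beta>" "is_ord \<gamma>"
  shows "natural_sum (natural_sum \<alpha> \<beta>) \<gamma> = natural_sum \<alpha> (natural_sum \<beta> \<gamma>)"
  using assms by (intro cnf_coeff_inject) (simp_all add: natural_sum add.assoc)

lemma natural_sum_zero: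
  assumes "is_ord \<alpha>"
  shows "natural_sum (nat_ord 0) \<alpha> = \<alpha>"
  using assms by (intro cnf_coeff_inject) (simp_all add: natural_sum)

text \<open>The same coefficients are added on both sides, so the exponent deciding the old
  comparison also decides the new one.\<close>

lemma natural_sum_less:
  assumes "is_ord \<beta>" "is_ord \<gamma>" "\<alpha> \<in> elts \<beta>"
  shows "natural_sum \<alpha> \<gamma> \<in> elts (natural_sum \<beta> \<gamma>)"
proof (rule lex_less_cnf_coeff)
  have \<alpha>: "is_ord \<alpha>"
    using assms is_ord_mem by blast
  show "is_ord (natural_sum \<alpha> \<gamma>)" "is_ord (natural_sum \<beta> \<gamma>)"
    using \<alpha> assms by (auto intro: is_ord_natural_sum)
  show "lex_less (cnf_coeff (natural_sum \<alpha> \<gamma>)) (cnf_coeff (natural_sum \<beta> \<gamma>))"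
    using cnf_coeff_lex_less[OF assms(1,3)]
    by (simp add: lex_less_def cnf_coeff_natural_sum \<alpha> assms)
qed

lemma natural_sum_le:
  assumes "is_ord \<beta>" "is_ord \<gamma>" "\<alpha> = \<beta> \<or> \<alpha> \<in> elts \<beta>"
  shows "natural_sum \<alpha> \<gamma> = natural_sum \<beta> \<gamma> \<or> natural_sum \<alpha> \<gamma> \<in> elts (natural_sum \<beta> \<gamma>)"
  using natural_sum_less[OF assms(1,2)] assms(3) by blast

text \<open>Coefficients in the natural numbers cannot cancel.\<close>

lemma natural_sum_eq_zero:
  assumes "is_ord \<alpha>" "is_ord \<beta>" "natural_sum \<alpha> \<beta> = nat_ord 0"
  shows "\<alpha> = nat_ord 0" "\<beta> = nat_ord 0"
proof -
  have "cnf_coeff \<alpha> \<zeta> + cnf_coeff \<beta> \<zeta> = 0" for \<zeta>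
    using cnf_coeff_natural_sum[OF assms(1,2)] assms(3) cnf_coeff_zero by metis
  then show "\<alpha> = nat_ord 0" "\<beta> = nat_ord 0"
    using assms by (auto intro!: cnf_coeff_inject)
qed

text \<open>The degree, as a relation: the zero function gets no invented degree, and conditions on
  all leading exponents hold for it vacuously.\<close>

definition leading :: "('a::mk_universe \<Rightarrow> 'b::zero) \<Rightarrow> 'a \<Rightarrow> bool" where
  "leading f \<delta> \<longleftrightarrow> is_ord \<delta> \<and> f \<delta> \<noteq> 0 \<and> (\<forall>\<eta>. f \<eta> \<noteq> 0 \<longrightarrow> \<eta> = \<delta> \<or> \<eta> \<in> elts \<delta>)"

lemma leading_unique: "leading f \<delta> \<Longrightarrow> leading f \<epsilon> \<Longrightarrow> \<delta> = \<epsilon>"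
  unfolding leading_def using mem_asym by metis

lemma leading_is_ord: "leading f \<delta> \<Longrightarrow> is_ord \<delta>"
  by (simp add: leading_def)

lemma ex_leading:
  assumes "ord_supported f" "f \<noteq> (\<lambda>_. 0)"
  shows "\<exists>\<delta>. leading f \<delta>"
proof -
  have "\<exists>m\<in>{\<zeta>. f \<zeta> \<noteq> 0}. \<forall>\<zeta>\<in>{\<zeta>. f \<zeta> \<noteq> 0}. \<zeta> = m \<or> \<zeta> \<in> elts m"
    using assms by (intro ord_finite_max) (auto simp: ord_supported_def)
  then show ?thesis
    using assms(1) by (auto simp: leading_def ord_supported_def)
qed

lemma leading_above: "leading f \<delta> \<Longrightarrow> \<delta> \<in> elts \<eta> \<Longrightarrow> f \<eta> = 0"
  unfolding leading_def using mem_asym mem_irrefl by metis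

text \<open>The larger of the two leading exponents decides, or the common one. A zero
  \<open>f\<close> has none and loses to the positive leading coefficient of
  \<open>g\<close>.\<close>

lemma lex_less_leading:
  fixes f g :: "'a::mk_universe \<Rightarrow> int"
  assumes f: "ord_supported f" and g: "leading g \<zeta>" "0 < g \<zeta>"
    and le: "\<And>\<xi>. leading f \<xi> \<Longrightarrow> f \<xi> < 0 \<or> \<xi> \<in> elts \<zeta> \<or> \<xi> = \<zeta> \<and> f \<xi> < g \<zeta>"
  shows "lex_less f g"
proof (cases "f = (\<lambda>_. 0)")
  case True
  then show ?thesis
    using g leading_above[OF g(1)] leading_is_ord[OF g(1)] unfolding lex_less_def by metis
next
  case False
  then obtain \<xi> where \<xi>: "leading f \<xi>"
    using ex_leading f by blast
  note ords = leading_is_ord[OF \<xi>] leading_is_ord[OF g(1)]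
  have z: "f \<eta> = g \<eta>" if "\<zeta> \<in> elts \<eta>" "\<xi> \<in> elts \<eta>" for \<eta>
    using leading_above[OF g(1) that(1)] leading_above[OF \<xi> that(2)] by simp
  consider "\<xi> \<in> elts \<zeta>" | "\<xi> = \<zeta>" | "\<zeta> \<in> elts \<xi>"
    using is_ord_linear ords by blast
  then show ?thesis
  proof cases
    case 1
    then have "f \<zeta> = 0" "\<And>\<eta>. is_ord \<eta> \<Longrightarrow> \<zeta> \<in> elts \<eta> \<Longrightarrow> \<xi> \<in> elts \<eta>"
      using leading_above[OF \<xi>] is_ord_trans by blast+
    then show ?thesis
      using z g(2) ords unfolding lex_less_def by metis
  next
    case 2
    then have "f \<zeta> < g \<zeta>"
      using le[OF \<xi>] g(2) by auto
    then show ?thesis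
      using z ords 2 unfolding lex_less_def by metis
  next
    \<comment> \<open>Of the assumption only \<open>f \<xi> < 0\<close> remains, while
      \<open>g \<xi> = 0\<close>; so \<xi> itself is the deciding exponent.\<close>
    case 3
    then have "f \<xi> < g \<xi>" "\<And>\<eta>. is_ord \<eta> \<Longrightarrow> \<xi> \<in> elts \<eta> \<Longrightarrow> \<zeta> \<in> elts \<eta>"
      using le[OF \<xi>] leading_above[OF g(1) 3] mem_asym[OF 3] mem_irrefl is_ord_trans by force+
    then show ?thesis
      using z ords unfolding lex_less_def by metis
  qed
qed

lemma conv_nonzero:
  "conv f g \<zeta> \<noteq> 0 \<Longrightarrow> \<exists>\<xi> \<eta>. f \<xi> \<noteq> 0 \<and> g \<eta> \<noteq> 0 \<and> natural_sum \<xi> \<eta> = \<zeta>"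
  unfolding conv_def by (erule sum.not_neutral_contains_not_neutral) auto

lemma ord_supported_conv:
  assumes "ord_supported f" "ord_supported g"
  shows "ord_supported (conv f g)"
proof -
  let ?S = "(\<lambda>(\<xi>, \<eta>). natural_sum \<xi> \<eta>) ` ({\<xi>. f \<xi> \<noteq> 0} \<times> {\<eta>. g \<eta> \<noteq> 0})"
  have sub: "{\<zeta>. conv f g \<zeta> \<noteq> 0} \<subseteq> ?S"
    using conv_nonzero[of f g] by fastforce
  have "finite ?S"
    using assms by (auto simp: ord_supported_def)
  moreover have "is_ord \<zeta>" if "\<zeta> \<in> ?S" for \<zeta>
    using that assms is_ord_natural_sum by (auto simp: ord_supported_def)
  ultimately show ?thesis
    using sub finite_subset[OF sub] unfolding ord_supported_def by simp blast
qed

lemma conv_zero_left: "conv (\<lambda>_. 0) g = (\<lambda>_. 0)" and conv_zero_right: "conv f (\<lambda>_. 0) = (\<lambda>_. 0)"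
  by (auto simp: conv_def)

text \<open>Strict monotonicity of the natural sum leaves a single pair contributing to the top exponent.\<close>
lemma leading_conv:
  fixes f g :: "'a::mk_universe \<Rightarrow> int"
  assumes f: "leading f \<alpha>" and g: "leading g \<beta>"
  shows "conv f g (natural_sum \<alpha> \<beta>) = f \<alpha> * g \<beta>" "leading (conv f g) (natural_sum \<alpha> \<beta>)"
proof -
  note ords = leading_is_ord[OF f] leading_is_ord[OF g]
  have le: "(\<xi> = \<alpha> \<and> \<eta> = \<beta>) \<or> natural_sum \<xi> \<eta> \<in> elts (natural_sum \<alpha> \<beta>)"
    if "f \<xi> \<noteq> 0" "g \<eta> \<noteq> 0" for \<xi> \<eta>
  proof -
    have \<xi>: "\<xi> = \<alpha> \<or> \<xi> \<in> elts \<alpha>" and \<eta>: "\<eta> = \<beta> \<or> \<eta> \<in> elts \<beta>"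
      using f g that by (auto simp: leading_def)
    then have o: "is_ord \<xi>" "is_ord \<eta>"
      using ords is_ord_mem by auto
    have "\<xi> = \<alpha> \<or> natural_sum \<xi> \<eta> \<in> elts (natural_sum \<alpha> \<eta>)"
      using natural_sum_less[OF ords(1) o(2)] \<xi> by blast
    moreover have "\<eta> = \<beta> \<or> natural_sum \<alpha> \<eta> \<in> elts (natural_sum \<alpha> \<beta>)"
      using natural_sum_less[OF ords(2,1)] \<eta> natural_sum_comm by metis
    ultimately show ?thesis
      using is_ord_trans[OF is_ord_natural_sum[OF ords]] by blast
  qed
  then have "{(\<xi>, \<eta>). f \<xi> \<noteq> 0 \<and> g \<eta> \<noteq> 0 \<and> natural_sum \<xi> \<eta> = natural_sum \<alpha> \<beta>} = {(\<alpha>, \<beta>)}"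
    using f g mem_irrefl by (fastforce simp: leading_def)
  then show eq: "conv f g (natural_sum \<alpha> \<beta>) = f \<alpha> * g \<beta>"
    by (simp add: conv_def)
  show "leading (conv f g) (natural_sum \<alpha> \<beta>)"
    unfolding leading_def
  proof (intro conjI allI impI)
    show "is_ord (natural_sum \<alpha> \<beta>)"
      using ords by (rule is_ord_natural_sum)
    show "conv f g (natural_sum \<alpha> \<beta>) \<noteq> 0"
      using eq f g by (simp add: leading_def)
    show "\<zeta> = natural_sum \<alpha> \<beta> \<or> \<zeta> \<in> elts (natural_sum \<alpha> \<beta>)" if "conv f g \<zeta> \<noteq> 0" for \<zeta>
      using conv_nonzero[OF that] le by metis
  qed
qed

text \<open>A nonzero product has nonzero factors, and uniqueness identifies the natural sum of
  their leading exponents with \<zeta>.\<close>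

lemma leading_conv_cases:
  fixes f g :: "'a::mk_universe \<Rightarrow> int"
  assumes "ord_supported f" "ord_supported g" "leading (conv f g) \<zeta>"
  obtains \<alpha> \<beta> where "leading f \<alpha>" "leading g \<beta>" "\<zeta> = natural_sum \<alpha> \<beta>"
    "conv f g \<zeta> = f \<alpha> * g \<beta>"
proof -
  have "f \<noteq> (\<lambda>_. 0)" "g \<noteq> (\<lambda>_. 0)"
    using assms(3) by (auto simp: leading_def conv_zero_left conv_zero_right)
  then obtain \<alpha> \<beta> where "leading f \<alpha>" "leading g \<beta>"
    using ex_leading assms by blast
  then show thesis
    using that leading_conv leading_unique[OF assms(3)] by metis
qed

section \<open>Arithmetic of Surintegers\<close>

lemma surintsE:
  assumes "x \<in> surints"
  obtains \<alpha> \<beta> where "x = kpair \<alpha> \<beta>" "is_ord \<alpha>" "is_ord \<beta>"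
    "\<forall>\<zeta>. cnf_coeff \<alpha> \<zeta> = 0 \<or> cnf_coeff \<beta> \<zeta> = 0"
  using assms by (auto simp: surints_def)

lemma ord_supported_z_coeff:
  assumes "x \<in> surints"
  shows "ord_supported (z_coeff x)"
proof -
  obtain \<alpha> \<beta> where x: "x = kpair \<alpha> \<beta>" "is_ord \<alpha>" "is_ord \<beta>"
    using assms by (rule surintsE) blast
  note sup = ord_supported_cnf_coeff[OF x(2)] ord_supported_cnf_coeff[OF x(3)]
  have sub: "{\<zeta>. z_coeff x \<zeta> \<noteq> 0} \<subseteq> {\<zeta>. cnf_coeff \<alpha> \<zeta> \<noteq> 0} \<union> {\<zeta>. cnf_coeff \<beta> \<zeta> \<noteq> 0}"
    by (auto simp: x z_coeff_def)
  have "finite {\<zeta>. z_coeff x \<zeta> \<noteq> 0}"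
    by (rule finite_subset[OF sub]) (use sup in \<open>simp add: ord_supported_def\<close>)
  then show ?thesis
    using sub sup unfolding ord_supported_def by blast
qed

text \<open>Disjoint supports make the two coordinates the positive and the negative part of the
  coefficient function, which therefore determines them.\<close>

lemma surint_eqI:
  assumes "x \<in> surints" "y \<in> surints" "z_coeff x = z_coeff y"
  shows "x = y"
proof -
  obtain \<alpha> \<beta> where x: "x = kpair \<alpha> \<beta>" "is_ord \<alpha>" "is_ord \<beta>"
    "\<forall>\<zeta>. cnf_coeff \<alpha> \<zeta> = 0 \<or> cnf_coeff \<beta> \<zeta> = 0"
    using assms(1) by (rule surintsE)
  obtain \<gamma> \<delta> where y: "y = kpair \<gamma> \<delta>" "is_ord \<gamma>" "is_ord \<delta>"
    "\<forall>\<zeta>. cnf_coeff \<gamma> \<zeta> = 0 \<or> cnf_coeff \<delta> \<zeta> = 0"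
    using assms(2) by (rule surintsE)
  have "cnf_coeff \<alpha> \<zeta> = cnf_coeff \<gamma> \<zeta> \<and> cnf_coeff \<beta> \<zeta> = cnf_coeff \<delta> \<zeta>" for \<zeta>
    using fun_cong[OF assms(3), of \<zeta>] spec[OF x(4), of \<zeta>] spec[OF y(4), of \<zeta>] by (auto simp: x(1) y(1) z_coeff_def)
  then show ?thesis
    using cnf_coeff_inject x y by (metis ext)
qed

lemma z_of_coeffs:
  assumes "ord_supported f"
  shows z_of_coeffs_surint: "z_of_coeffs f \<in> surints"
    and z_coeff_z_of_coeffs: "z_coeff (z_of_coeffs f) = f"
proof -
  have nonzero: "nat (f \<zeta>) \<noteq> 0 \<Longrightarrow> f \<zeta> \<noteq> 0" "nat (- f \<zeta>) \<noteq> 0 \<Longrightarrow> f \<zeta> \<noteq> 0" for \<zeta>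
    by auto
  have "finite {\<zeta>. nat (f \<zeta>) \<noteq> 0}" "finite {\<zeta>. nat (- f \<zeta>) \<noteq> 0}"
    using assms nonzero by (auto simp: ord_supported_def elim!: finite_subset[rotated])
  then have sup: "ord_supported (\<lambda>\<zeta>. nat (f \<zeta>))" "ord_supported (\<lambda>\<zeta>. nat (- f \<zeta>))"
    using assms nonzero unfolding ord_supported_def by blast+
  note c = cnf_coeff_ord_of_coeffs[OF sup(1)] cnf_coeff_ord_of_coeffs[OF sup(2)]
  show "z_of_coeffs f \<in> surints"
    unfolding surints_def z_of_coeffs_def
    using sup[THEN is_ord_ord_of_coeffs] c by force
  show "z_coeff (z_of_coeffs f) = f"
    by (simp add: z_coeff_def z_of_coeffs_def c fun_eq_iff)
qed

lemma z_coeff_z_mul: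
  assumes "x \<in> surints" "y \<in> surints"
  shows "z_coeff (z_mul x y) = conv (z_coeff x) (z_coeff y)"
  unfolding z_mul_def by (intro z_coeff_z_of_coeffs ord_supported_conv ord_supported_z_coeff assms)

lemma z_less_iff: "z_less x y \<longleftrightarrow> lex_less (z_coeff x) (z_coeff y)"
  by (simp add: z_less_def lex_less_def)

lemma surint_of_ord:
  assumes "is_ord \<alpha>"
  shows "kpair \<alpha> (nat_ord 0) \<in> surints"
  using assms is_ord_zero by (auto simp: surints_def simp del: is_ord_zero)

lemma z_coeff_of_ord: "z_coeff (kpair \<alpha> (nat_ord 0)) \<zeta> = int (cnf_coeff \<alpha> \<zeta>)"
  by (simp add: z_coeff_def)

lemma z_one_surint: "z_one \<in> surints"
  unfolding z_one_def by (rule surint_of_ord) (rule is_ord_nat_ord)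

lemma z_coeff_one: "z_coeff z_one = (\<lambda>\<zeta>. if \<zeta> = nat_ord 0 then 1 else 0)"
  unfolding z_one_def by (simp only: fun_eq_iff z_coeff_of_ord cnf_coeff_one) simp

lemma leading_z_one: "leading (z_coeff z_one) (nat_ord 0)"
  by (simp add: leading_def z_coeff_one)

lemma z_neg_one:
  "z_neg (z_one :: 'a::mk_universe) \<in> surints"
  "z_coeff (z_neg z_one) = (\<lambda>\<zeta> :: 'a. if \<zeta> = nat_ord 0 then - 1 else 0)"
proof -
  have neg: "(\<lambda>\<zeta>. - z_coeff z_one \<zeta>) = (\<lambda>\<zeta> :: 'a. if \<zeta> = nat_ord 0 then - 1 else 0)"
    by (auto simp: z_coeff_one)
  have "ord_supported (\<lambda>\<zeta> :: 'a. if \<zeta> = nat_ord 0 then - 1 else 0 :: int)"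
    by (auto simp: ord_supported_def)
  from z_of_coeffs[OF this] show "z_neg (z_one :: 'a) \<in> surints"
    "z_coeff (z_neg z_one) = (\<lambda>\<zeta> :: 'a. if \<zeta> = nat_ord 0 then - 1 else 0)"
    by (simp_all only: z_neg_def neg)
qed

lemma leading_zero_eq:
  assumes "leading f (nat_ord 0)"
  shows "f = (\<lambda>\<zeta>. if \<zeta> = nat_ord 0 then f (nat_ord 0) else 0)"
proof
  fix \<zeta>
  have "\<zeta> = nat_ord 0" if "f \<zeta> \<noteq> 0"
    using assms that unfolding leading_def elts_zero by blast
  then show "f \<zeta> = (if \<zeta> = nat_ord 0 then f (nat_ord 0) else 0)"
    by (cases "\<zeta> = nat_ord 0") auto
qed

text \<open>Exponents add up to zero only if both vanish, so a divisor of one is an integer unit.\<close>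
lemma z_dvd_one:
  assumes "d \<in> surints" "z_dvd d z_one"
  shows "d = z_one \<or> d = z_neg z_one"
proof -
  obtain e where e: "e \<in> surints" "z_one = z_mul d e"
    using assms(2) by (auto simp: z_dvd_def)
  have eq: "z_coeff z_one = conv (z_coeff d) (z_coeff e)"
    unfolding e(2) by (rule z_coeff_z_mul[OF assms(1) e(1)])
  obtain \<alpha> \<beta> where ab: "leading (z_coeff d) \<alpha>" "leading (z_coeff e) \<beta>"
    "nat_ord 0 = natural_sum \<alpha> \<beta>"
    "conv (z_coeff d) (z_coeff e) (nat_ord 0) = z_coeff d \<alpha> * z_coeff e \<beta>"
    using leading_conv_cases[OF ord_supported_z_coeff[OF assms(1)] ord_supported_z_coeff[OF e(1)]]
      leading_z_one eq by metis
  have \<alpha>: "\<alpha> = nat_ord 0"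
    using natural_sum_eq_zero(1)[OF ab(1,2)[THEN leading_is_ord]] ab(3) by simp
  have "z_coeff d \<alpha> * z_coeff e \<beta> = 1"
    using ab(4) by (simp add: eq[symmetric] z_coeff_one)
  then have "z_coeff d \<alpha> = 1 \<or> z_coeff d \<alpha> = - 1"
    by (rule zmult_eq_1_iff[THEN iffD1, THEN disj_forward]) auto
  then show ?thesis
  proof
    assume "z_coeff d \<alpha> = 1"
    then have "z_coeff d = z_coeff z_one"
      unfolding z_coeff_one by (subst leading_zero_eq[OF ab(1)[unfolded \<alpha>]]) (simp add: \<alpha> fun_eq_iff)
    then show ?thesis
      using surint_eqI[OF assms(1) z_one_surint] by blast
  next
    assume "z_coeff d \<alpha> = - 1"
    then have "z_coeff d = z_coeff (z_neg z_one)"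
      unfolding z_neg_one(2) by (subst leading_zero_eq[OF ab(1)[unfolded \<alpha>]]) (simp add: \<alpha> fun_eq_iff)
    then show ?thesis
      using surint_eqI[OF assms(1) z_neg_one(1)] by blast
  qed
qed

lemma z_coeff_zero: "z_coeff z_zero = (\<lambda>_. 0)"
  by (simp add: z_zero_def z_coeff_def fun_eq_iff)

text \<open>A common divisor of \<open>a\<close> and 1 divides 1 and so is a unit. With denominator
  1, fractions are reduced without any theory of common divisors.\<close>

lemma surrat_of_surint:
  assumes "a \<in> surints"
  shows "kpair a z_one \<in> surrats"
proof -
  have "lex_less (z_coeff z_zero :: 'a \<Rightarrow> int) (z_coeff z_one)"
    unfolding lex_less_def by (intro exI[of _ "nat_ord 0"]) (auto simp: z_coeff_zero z_coeff_one)
  then show ?thesis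
    using assms z_one_surint z_dvd_one by (auto simp: surrats_def z_less_iff)
qed

text \<open>The exponent that decides the comparison with zero is the largest in the support,
  because above it the coefficients equal those of zero.\<close>

lemma surrats_denom:
  assumes "p \<in> surrats"
  obtains \<beta> where "leading (z_coeff (ksnd p)) \<beta>" "0 < z_coeff (ksnd p) \<beta>"
proof -
  have b: "ksnd p \<in> surints" "lex_less (z_coeff z_zero) (z_coeff (ksnd p))"
    using assms by (auto simp: surrats_def z_less_iff)
  then obtain \<zeta> where \<zeta>: "is_ord \<zeta>" "0 < z_coeff (ksnd p) \<zeta>"
    "\<And>\<eta>. is_ord \<eta> \<Longrightarrow> \<zeta> \<in> elts \<eta> \<Longrightarrow> z_coeff (ksnd p) \<eta> = 0"
    unfolding lex_less_def z_coeff_zero by metis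
  have "\<eta> = \<zeta> \<or> \<eta> \<in> elts \<zeta>" if "z_coeff (ksnd p) \<eta> \<noteq> 0" for \<eta>
  proof -
    have "is_ord \<eta>"
      using that ord_supported_z_coeff[OF b(1)] by (simp add: ord_supported_def)
    then show ?thesis
      using is_ord_linear[OF _ \<zeta>(1)] \<zeta>(3) that by blast
  qed
  then have "leading (z_coeff (ksnd p)) \<zeta>"
    using \<zeta>(1,2) by (simp add: leading_def)
  then show thesis
    using \<zeta>(2) by (rule that)
qed


section \<open>Transfinite times-numbers\<close>

lemma is_ord_natural_prod:
  assumes "is_ord \<alpha>" "is_ord \<beta>"
  shows "is_ord (natural_prod \<alpha> \<beta>)"
  unfolding natural_prod_def
  by (intro is_ord_ord_of_coeffs ord_supported_conv ord_supported_cnf_coeff assms)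

text \<open>Closing off in omega steps: two ordinals below the union of the stages lie in a common
  stage, and the next stage contains their product.\<close>

lemma ex_times_number_above:
  fixes X :: "'a::mk_universe set"
  assumes "is_set X" "\<And>x. x \<in> X \<Longrightarrow> is_ord x"
  shows "\<exists>l. transfinite_times_number l \<and> X \<subseteq> elts l"
proof -
  define next_ord :: "'a \<Rightarrow> 'a" where
    "next_ord = (\<lambda>x. SOME y. is_ord y \<and> elts x \<subseteq> elts y \<and>
      (\<forall>\<beta>\<in>elts x. \<forall>\<gamma>\<in>elts x. natural_prod \<beta> \<gamma> \<in> elts y))"
  have step: "is_ord (next_ord x)" "elts x \<subseteq> elts (next_ord x)"
    "\<And>\<beta> \<gamma>. \<beta> \<in> elts x \<Longrightarrow> \<gamma> \<in> elts x \<Longrightarrow> natural_prod \<beta> \<gamma> \<in> elts (next_ord x)"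
    if x: "is_ord x" for x
  proof -
    \<comment> \<open>By replacement and union, the elements of \<open>x\<close> and their products
      form a set, so some ordinal lies above all of them.\<close>
    let ?Y = "elts x \<union> (\<Union>\<beta>\<in>elts x. natural_prod \<beta> ` elts x)"
    have "is_set ?Y"
      by (intro is_set_Un is_set_UN is_set_image is_set_elts)
    moreover have "is_ord y" if "y \<in> ?Y" for y
      using that is_ord_mem[OF x] is_ord_natural_prod by auto
    ultimately obtain y where "is_ord y" "?Y \<subseteq> elts y"
      using ex_ord_above by meson
    then have "\<exists>y. is_ord y \<and> elts x \<subseteq> elts y \<and>
        (\<forall>\<beta>\<in>elts x. \<forall>\<gamma>\<in>elts x. natural_prod \<beta> \<gamma> \<in> elts y)"
      by (intro exI[of _ y]) blast
    from someI_ex[OF this, folded next_ord_def] show "is_ord (next_ord x)"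
      "elts x \<subseteq> elts (next_ord x)"
      "\<And>\<beta> \<gamma>. \<beta> \<in> elts x \<Longrightarrow> \<gamma> \<in> elts x \<Longrightarrow> natural_prod \<beta> \<gamma> \<in> elts (next_ord x)"
      by (simp_all add: next_ord_def)
  qed
  have "is_set (X \<union> elts omega)" "\<And>x. x \<in> X \<union> elts omega \<Longrightarrow> is_ord x"
    using assms by (auto simp: elts_omega is_set_range)
  then obtain l0 where l0: "is_ord l0" "X \<union> elts omega \<subseteq> elts l0"
    using ex_ord_above by meson
  define f where "f n = (next_ord ^^ n) l0" for n
  have f0: "f 0 = l0" and fS: "f (Suc n) = next_ord (f n)" for n
    by (simp_all add: f_def)
  have ord: "is_ord (f n)" for n
    by (induction n) (simp_all add: f0 fS l0 step)
  have mono: "m \<le> n \<Longrightarrow> elts (f m) \<subseteq> elts (f n)" for m n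
  proof (induction rule: dec_induct)
    case (step n)
    then show ?case
      using \<open>\<And>x. is_ord x \<Longrightarrow> elts x \<subseteq> elts (next_ord x)\<close>[OF ord[of n]] by (simp add: fS)
  qed simp
  define l where "l = set_of (\<Union>x\<in>range f. elts x)"
  have l: "is_ord l" "elts l = (\<Union>n. elts (f n))"
    unfolding l_def using is_ord_Union[OF is_set_range, of f] ord by auto
  have "natural_prod \<beta> \<gamma> \<in> elts l" if bc: "\<beta> \<in> elts l" "\<gamma> \<in> elts l" for \<beta> \<gamma>
  proof -
    obtain m n where mn: "\<beta> \<in> elts (f m)" "\<gamma> \<in> elts (f n)"
      using bc unfolding l(2) by blast
    then have "\<beta> \<in> elts (f (max m n))" "\<gamma> \<in> elts (f (max m n))"
      using mono[of m "max m n"] mono[of n "max m n"] by auto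
    then have "natural_prod \<beta> \<gamma> \<in> elts (f (Suc (max m n)))"
      unfolding fS by (rule step(3)[OF ord])
    then show ?thesis
      unfolding l(2) by blast
  qed
  moreover have "X \<union> elts omega \<subseteq> elts l"
    using l0(2) f0 unfolding l(2) by blast
  ultimately show ?thesis
    using l(1) by (auto simp: transfinite_times_number_def)
qed

section \<open>Cuts\<close>

text \<open>The elements \<open>a / b\<close> with \<open>a \<le> 0\<close> or whose degree \<open>deg a - deg b\<close> is at most \<open>\<delta>\<close>.\<close>
definition degree_cut :: "'a::mk_universe \<Rightarrow> 'a \<Rightarrow> 'a set" where
  "degree_cut l \<delta> = {p \<in> surrats_below l. \<forall>\<alpha> \<beta>. leading (z_coeff (kfst p)) \<alpha> \<longrightarrow>
     0 < z_coeff (kfst p) \<alpha> \<longrightarrow> leading (z_coeff (ksnd p)) \<beta> \<longrightarrow>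
     \<alpha> = natural_sum \<beta> \<delta> \<or> \<alpha> \<in> elts (natural_sum \<beta> \<delta>)}"

lemma surrats_below_surints:
  assumes "p \<in> surrats_below l"
  shows "p \<in> surrats" "kfst p \<in> surints" "ksnd p \<in> surints"
  using assms by (auto simp: surrats_below_def surints_below_def)

text \<open>The fractions are pairs of pairs of elements of \<open>l\<close>. Without this bound
  \<open>set_of\<close> would say nothing about cuts or about \<open>real_set\<close>.\<close>

lemma is_set_surrats_below: "is_set (surrats_below l)"
proof -
  have pair: "z = kpair (kfst z) (ksnd z)" if "z \<in> surints \<or> z \<in> surrats" for z :: 'a
    using that by (auto simp: surints_def surrats_def)
  have "surints_below l \<subseteq> {kpair x y |x y. x \<in> elts l \<and> y \<in> elts l}"
    using pair unfolding surints_below_def by blast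
  then have "is_set (surints_below l)"
    by (rule is_set_mono[OF is_set_kpairs[OF is_set_elts is_set_elts]])
  moreover have "surrats_below l \<subseteq> {kpair x y |x y. x \<in> surints_below l \<and> y \<in> surints_below l}"
    using pair unfolding surrats_below_def by blast
  ultimately show ?thesis
    using is_set_mono is_set_kpairs by blast
qed

lemma elts_real_set: "elts (real_set l) = {L. is_cut l L}"
  unfolding real_set_def
proof (rule elts_set_of)
  have "{L. is_cut l L} \<subseteq> {L. elts L \<subseteq> surrats_below l}"
    by (auto simp: is_cut_def)
  then show "is_set {L. is_cut l L}"
    by (rule is_set_mono[OF is_set_Pow[OF is_set_surrats_below]])
qed

lemma surrat_of_ord:
  assumes "is_ord \<alpha>" "\<alpha> \<in> elts l" "transfinite_times_number l"
  shows "kpair (kpair \<alpha> (nat_ord 0)) z_one \<in> surrats_below l"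
proof -
  have nat: "nat_ord n \<in> elts l" for n
    using assms(3) elts_omega unfolding transfinite_times_number_def by blast
  have "kpair \<alpha> (nat_ord 0) \<in> surints_below l"
    using surint_of_ord[OF assms(1)] assms(2) nat[of 0] by (simp add: surints_below_def)
  moreover have "z_one \<in> surints_below l"
    using z_one_surint nat[of 0] nat[of 1] by (simp add: surints_below_def z_one_def)
  ultimately show ?thesis
    using surrat_of_surint[OF surint_of_ord[OF assms(1)]] by (simp add: surrats_below_def)
qed

lemma leading_cterm:
  assumes "is_ord \<delta>" "0 < c"
  shows "leading (z_coeff (kpair (cterm \<delta> c) (nat_ord 0))) \<delta>"
    "z_coeff (kpair (cterm \<delta> c) (nat_ord 0)) \<delta> = int c"
  using assms by (simp_all add: leading_def z_coeff_of_ord cnf_coeff_cterm)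

text \<open>Write p = a/b and q = c/d. Outside the cut c is positive and deg c > deg d + \<delta>;
  inside, a positive a has deg a \<le> deg b + \<delta>. With natural sums, deg(ad) \<le> deg b +
  \<delta> + deg d < deg(bc). If a is negative, the sign of the product ad decides.\<close>

lemma degree_cut_below:
  assumes "is_ord \<delta>" "p \<in> degree_cut l \<delta>" "q \<in> surrats_below l - degree_cut l \<delta>"
  shows "q_less p q"
proof -
  let ?a = "z_coeff (kfst p)" and ?b = "z_coeff (ksnd p)"
  let ?c = "z_coeff (kfst q)" and ?d = "z_coeff (ksnd q)"
  have p: "p \<in> surrats_below l" and q: "q \<in> surrats_below l"
    using assms by (auto simp: degree_cut_def)
  note P = surrats_below_surints[OF p] and Q = surrats_below_surints[OF q]
  obtain \<gamma> \<epsilon> where c: "leading ?c \<gamma>" "0 < ?c \<gamma>" and d: "leading ?d \<epsilon>"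
    and not_le: "\<not> (\<gamma> = natural_sum \<epsilon> \<delta> \<or> \<gamma> \<in> elts (natural_sum \<epsilon> \<delta>))"
    using assms(3) q unfolding degree_cut_def by blast
  have d_pos: "0 < ?d \<epsilon>"
    using surrats_denom[OF Q(1)] leading_unique[OF d] by metis
  obtain \<beta> where b: "leading ?b \<beta>" "0 < ?b \<beta>"
    using surrats_denom[OF P(1)] .
  note ords = b(1)[THEN leading_is_ord] c(1)[THEN leading_is_ord] d[THEN leading_is_ord]
  have lt: "natural_sum \<epsilon> \<delta> \<in> elts \<gamma>"
    using is_ord_linear[OF ords(2) is_ord_natural_sum[OF ords(3) assms(1)]] not_le by blast
  have "lex_less (conv ?a ?d) (conv ?b ?c)"
  proof (rule lex_less_leading)
    show "ord_supported (conv ?a ?d)"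
      by (intro ord_supported_conv ord_supported_z_coeff P Q)
    show "leading (conv ?b ?c) (natural_sum \<beta> \<gamma>)"
      by (rule leading_conv(2)[OF b(1) c(1)])
    show "0 < conv ?b ?c (natural_sum \<beta> \<gamma>)"
      using b(2) c(2) by (simp add: leading_conv(1)[OF b(1) c(1)])
    fix \<xi> assume \<xi>: "leading (conv ?a ?d) \<xi>"
    obtain \<alpha> \<epsilon>' where a: "leading ?a \<alpha>" "leading ?d \<epsilon>'" "\<xi> = natural_sum \<alpha> \<epsilon>'"
      "conv ?a ?d \<xi> = ?a \<alpha> * ?d \<epsilon>'"
      using leading_conv_cases[OF ord_supported_z_coeff[OF P(2)] ord_supported_z_coeff[OF Q(3)] \<xi>]
      by metis
    have \<epsilon>': "\<epsilon>' = \<epsilon>"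
      using leading_unique a(2) d by blast
    show "conv ?a ?d \<xi> < 0 \<or> \<xi> \<in> elts (natural_sum \<beta> \<gamma>) \<or>
        \<xi> = natural_sum \<beta> \<gamma> \<and> conv ?a ?d \<xi> < conv ?b ?c (natural_sum \<beta> \<gamma>)"
    proof (cases "0 < ?a \<alpha>")
      case True
      then have "\<alpha> = natural_sum \<beta> \<delta> \<or> \<alpha> \<in> elts (natural_sum \<beta> \<delta>)"
        using assms(2) a(1) b(1) unfolding degree_cut_def by blast
      then have "\<xi> = natural_sum (natural_sum \<beta> \<delta>) \<epsilon> \<or> \<xi> \<in> elts (natural_sum (natural_sum \<beta> \<delta>) \<epsilon>)"
        unfolding a(3) \<epsilon>' by (rule natural_sum_le[OF is_ord_natural_sum[OF ords(1) assms(1)] ords(3)])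
      moreover have "natural_sum (natural_sum \<beta> \<delta>) \<epsilon> = natural_sum (natural_sum \<epsilon> \<delta>) \<beta>"
        by (simp only: natural_sum_assoc[OF ords(1) assms(1) ords(3)] natural_sum_comm[of \<delta> \<epsilon>]
            natural_sum_comm[of \<beta> "natural_sum \<epsilon> \<delta>"])
      moreover have "natural_sum (natural_sum \<epsilon> \<delta>) \<beta> \<in> elts (natural_sum \<beta> \<gamma>)"
        using natural_sum_less[OF ords(2,1) lt] by (simp only: natural_sum_comm[of \<beta> \<gamma>])
      ultimately have "\<xi> \<in> elts (natural_sum \<beta> \<gamma>)"
        using is_ord_trans[OF is_ord_natural_sum[OF ords(1,2)]] by metis
      then show ?thesis by blast
    next
      case False
      then have "?a \<alpha> < 0"
        using a(1) by (simp add: leading_def)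
      then have "conv ?a ?d \<xi> < 0"
        using a(4) d_pos \<epsilon>' by (simp add: mult_neg_pos)
      then show ?thesis by blast
    qed
  qed
  then have "q_le p q"
    unfolding q_le_def z_le_def z_less_iff z_coeff_z_mul[OF P(2) Q(3)] z_coeff_z_mul[OF P(3) Q(2)]
    by blast
  \<comment> \<open>\<open>q_less\<close> also asks for \<open>p \<noteq> q\<close>, which holds
    since only \<open>p\<close> lies in the cut.\<close>
  then show ?thesis
    using assms unfolding q_less_def by blast
qed

text \<open>For m = a/b in the cut, (omega^\<delta> n)/1 has degree \<delta> and escapes m once
  omega^\<delta> n b > a. The leading terms give this for every n > 0 unless a is positive with
  degree exactly deg b + \<delta>; then n must beat the leading coefficient of a.\<close>

lemma degree_cut_no_max:
  assumes l: "transfinite_times_number l" and \<delta>: "is_ord \<delta>" "\<And>n. cterm \<delta> n \<in> elts l"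
    and m: "m \<in> degree_cut l \<delta>"
  shows "\<exists>q\<in>degree_cut l \<delta>. \<not> q_le q m"
proof -
  let ?a = "z_coeff (kfst m)" and ?b = "z_coeff (ksnd m)"
  have m': "m \<in> surrats_below l"
    using m by (simp add: degree_cut_def)
  note M = surrats_below_surints[OF m']
  obtain \<beta> where b: "leading ?b \<beta>" "0 < ?b \<beta>"
    using surrats_denom[OF M(1)] .
  have comm: "natural_sum \<delta> \<beta> = natural_sum \<beta> \<delta>"
    by (rule natural_sum_comm)
  \<comment> \<open>A coefficient beating the leading one of \<open>a\<close>, in case \<open>a / b\<close> has degree exactly \<open>\<delta>\<close>.\<close>
  define n where "n = Suc (nat (?a (natural_sum \<beta> \<delta>)))"
  define x where "x = kpair (cterm \<delta> n) (nat_ord 0)"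
  have x: "x \<in> surints" "leading (z_coeff x) \<delta>" "z_coeff x \<delta> = int n"
    unfolding x_def
    using surint_of_ord[OF is_ord_cterm[OF \<delta>(1)]] leading_cterm[OF \<delta>(1), of n] n_def by blast+
  have q: "kpair x z_one \<in> degree_cut l \<delta>"
    unfolding degree_cut_def
  proof (intro CollectI conjI allI impI)
    show "kpair x z_one \<in> surrats_below l"
      unfolding x_def using surrat_of_ord[OF is_ord_cterm[OF \<delta>(1)] \<delta>(2) l] .
    fix \<alpha> \<beta>' assume "leading (z_coeff (kfst (kpair x z_one))) \<alpha>"
      "leading (z_coeff (ksnd (kpair x z_one))) \<beta>'"
    then have "\<alpha> = \<delta>" "\<beta>' = nat_ord 0"
      using leading_unique x(2) leading_z_one by (metis kfst_kpair, metis ksnd_kpair)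
    then show "\<alpha> = natural_sum \<beta>' \<delta> \<or> \<alpha> \<in> elts (natural_sum \<beta>' \<delta>)"
      using natural_sum_zero[OF \<delta>(1)] by simp
  qed
  have lex: "lex_less (conv (z_coeff z_one) ?a) (conv (z_coeff x) ?b)"
  proof (rule lex_less_leading)
    show "ord_supported (conv (z_coeff z_one) ?a)"
      by (intro ord_supported_conv ord_supported_z_coeff M z_one_surint)
    show "leading (conv (z_coeff x) ?b) (natural_sum \<beta> \<delta>)"
      using leading_conv(2)[OF x(2) b(1)] by (simp only: comm)
    have val: "conv (z_coeff x) ?b (natural_sum \<beta> \<delta>) = int n * ?b \<beta>"
      using leading_conv(1)[OF x(2) b(1)] by (simp only: comm x(3))
    then show "0 < conv (z_coeff x) ?b (natural_sum \<beta> \<delta>)"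
      using b(2) by (simp add: n_def)
    fix \<xi> assume \<xi>: "leading (conv (z_coeff z_one) ?a) \<xi>"
    obtain \<zeta> \<alpha> where a: "leading (z_coeff z_one) \<zeta>" "leading ?a \<alpha>" "\<xi> = natural_sum \<zeta> \<alpha>"
      "conv (z_coeff z_one) ?a \<xi> = z_coeff z_one \<zeta> * ?a \<alpha>"
      using leading_conv_cases[OF ord_supported_z_coeff[OF z_one_surint]
          ord_supported_z_coeff[OF M(2)] \<xi>] by metis
    have \<zeta>: "\<zeta> = nat_ord 0"
      using leading_unique[OF a(1) leading_z_one] .
    have \<xi>\<alpha>: "\<xi> = \<alpha>" and val': "conv (z_coeff z_one) ?a \<xi> = ?a \<alpha>"
      using a(3,4) natural_sum_zero[OF leading_is_ord[OF a(2)]] by (simp_all add: \<zeta> z_coeff_one)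
    show "conv (z_coeff z_one) ?a \<xi> < 0 \<or> \<xi> \<in> elts (natural_sum \<beta> \<delta>) \<or>
        \<xi> = natural_sum \<beta> \<delta> \<and>
        conv (z_coeff z_one) ?a \<xi> < conv (z_coeff x) ?b (natural_sum \<beta> \<delta>)"
    proof (cases "0 < ?a \<alpha>")
      case True
      then have "\<alpha> = natural_sum \<beta> \<delta> \<or> \<alpha> \<in> elts (natural_sum \<beta> \<delta>)"
        using m a(2) b(1) unfolding degree_cut_def by blast
      moreover have "?a \<alpha> < int n * ?b \<beta>" if "\<alpha> = natural_sum \<beta> \<delta>"
      proof -
        have "?a \<alpha> < int n"
          unfolding n_def that by linarith
        \<comment> \<open>The leading coefficient of the denominator is a positive integer, hence at
          least 1.\<close>
        also have "\<dots> \<le> int n * ?b \<beta>"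
          using b(2) by (simp add: mult_le_cancel_left1)
        finally show ?thesis .
      qed
      ultimately show ?thesis
        by (simp only: val val') (simp only: \<xi>\<alpha>, blast)
    next
      case False
      then have "?a \<alpha> < 0"
        using a(2) by (simp add: leading_def)
      then show ?thesis
        unfolding val' by blast
    qed
  qed
  have "\<not> q_le (kpair x z_one) m"
  proof
    assume "q_le (kpair x z_one) m"
    then have "lex_less (z_coeff (z_mul x (ksnd m))) (z_coeff (z_mul z_one (kfst m))) \<or>
        z_mul x (ksnd m) = z_mul z_one (kfst m)"
      by (simp add: q_le_def z_le_def z_less_iff)
    then have "lex_less (conv (z_coeff x) ?b) (conv (z_coeff z_one) ?a) \<or>
        conv (z_coeff x) ?b = conv (z_coeff z_one) ?a"
      using z_coeff_z_mul[OF x(1) M(3)] z_coeff_z_mul[OF z_one_surint M(2)] by metis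
    then show False
      using lex lex_less_asym by metis
  qed
  then show ?thesis
    using q by blast
qed

text \<open>\<open>above\<close> keeps the cut proper: omega^(\<delta>+1) has too large a degree to
  belong to it. The multiples of omega^\<delta> rule out a greatest element, and the last conclusion
  places omega^\<delta> where \<delta> can be recovered from it.\<close>

lemma is_cut_degree_cut:
  assumes l: "transfinite_times_number l" and \<delta>: "is_ord \<delta>" "\<And>n. cterm \<delta> n \<in> elts l"
    and above: "cterm (osuc \<delta>) 1 \<in> elts l"
  shows "is_cut l (set_of (degree_cut l \<delta>))" "elts (set_of (degree_cut l \<delta>)) = degree_cut l \<delta>"
    "kpair (kpair (cterm \<delta> 1) (nat_ord 0)) z_one \<in> degree_cut l \<delta>"
proof -
  have sub: "degree_cut l \<delta> \<subseteq> surrats_below l"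
    by (auto simp: degree_cut_def)
  show e: "elts (set_of (degree_cut l \<delta>)) = degree_cut l \<delta>"
    by (rule elts_set_of, rule is_set_mono[OF is_set_surrats_below sub])
  have s: "is_ord (osuc \<delta>)"
    using \<delta>(1) by (rule is_ord_osuc)
  let ?q = "kpair (kpair (cterm (osuc \<delta>) 1) (nat_ord 0)) z_one"
  have below: "?q \<in> surrats_below l"
    using surrat_of_ord[OF is_ord_cterm[OF s] above l] .
  have "?q \<notin> degree_cut l \<delta>"
  proof
    assume "?q \<in> degree_cut l \<delta>"
    then have "osuc \<delta> = natural_sum (nat_ord 0) \<delta> \<or> osuc \<delta> \<in> elts (natural_sum (nat_ord 0) \<delta>)"
      using leading_cterm[OF s, of 1] leading_z_one unfolding degree_cut_def by auto
    then have "osuc \<delta> = \<delta> \<or> osuc \<delta> \<in> elts \<delta>"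
      by (simp only: natural_sum_zero[OF \<delta>(1)])
    moreover have "\<delta> \<in> elts (osuc \<delta>)"
      by simp
    ultimately show False
      using mem_asym mem_irrefl by metis
  qed
  then have "degree_cut l \<delta> \<subset> surrats_below l"
    using sub below by blast
  then show "is_cut l (set_of (degree_cut l \<delta>))"
    unfolding is_cut_def e using degree_cut_no_max[OF l \<delta>] degree_cut_below[OF \<delta>(1)] by blast
  show "kpair (kpair (cterm \<delta> 1) (nat_ord 0)) z_one \<in> degree_cut l \<delta>"
    unfolding degree_cut_def
  proof (intro CollectI conjI allI impI)
    show "kpair (kpair (cterm \<delta> 1) (nat_ord 0)) z_one \<in> surrats_below l"
      using surrat_of_ord[OF is_ord_cterm[OF \<delta>(1)] \<delta>(2) l] .
    fix \<alpha> \<beta>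
    assume "leading (z_coeff (kfst (kpair (kpair (cterm \<delta> 1) (nat_ord 0)) z_one))) \<alpha>"
      "leading (z_coeff (ksnd (kpair (kpair (cterm \<delta> 1) (nat_ord 0)) z_one))) \<beta>"
    then have "\<alpha> = \<delta>" "\<beta> = nat_ord 0"
      using leading_unique leading_cterm(1)[OF \<delta>(1) zero_less_one] leading_z_one
      by (metis kfst_kpair, metis ksnd_kpair)
    then show "\<alpha> = natural_sum \<beta> \<delta> \<or> \<alpha> \<in> elts (natural_sum \<beta> \<delta>)"
      using natural_sum_zero[OF \<delta>(1)] by simp
  qed
qed

section \<open>From large cuts to proper classes\<close>

lemma ex_large_cut:
  fixes \<delta> :: "'a::mk_universe"
  assumes "is_ord \<delta>"
  shows "\<exists>l L. transfinite_times_number l \<and> L \<in> elts (real_set l) \<and>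
    kpair (kpair (cterm \<delta> 1) (nat_ord 0)) z_one \<in> elts L"
proof -
  \<comment> \<open>The cut requires only these ordinals below \<open>l\<close>, and they form a
    set, so a times-number exceeds them all.\<close>
  have "is_set (insert (cterm (osuc \<delta>) 1) (range (cterm \<delta>)))"
    by (intro is_set_insert is_set_range)
  moreover have "is_ord x" if "x \<in> insert (cterm (osuc \<delta>) 1) (range (cterm \<delta>))" for x
    using that is_ord_cterm[OF assms] is_ord_cterm[OF is_ord_osuc[OF assms]] by blast
  ultimately obtain l where l: "transfinite_times_number l"
    "insert (cterm (osuc \<delta>) 1) (range (cterm \<delta>)) \<subseteq> elts l"
    using ex_times_number_above by meson
  then have "cterm \<delta> n \<in> elts l" "cterm (osuc \<delta>) 1 \<in> elts l" for n
    by auto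
  note cut = is_cut_degree_cut[OF l(1) assms this]
  show ?thesis
    using l(1) cut elts_real_set by blast
qed

lemma proper_class_real_sets:
  "proper_class {real_set l |l :: 'a::mk_universe. transfinite_times_number l}"
  unfolding proper_class_def
proof
  let ?S = "{real_set l |l :: 'a. transfinite_times_number l}"
  let ?ON = "{\<delta> :: 'a. is_ord \<delta>}"
  assume "is_set ?S"
  then have "is_set (\<Union>L\<in>(\<Union>r\<in>?S. elts r). elts L)"
    by (intro is_set_UN is_set_elts)
  \<comment> \<open>Two first projections take ((omega^\<delta>, 0), 1) to omega^\<delta>. Other
    fractions can only enlarge the image, and an inclusion suffices.\<close>
  then have "is_set ((\<lambda>q. kfst (kfst q)) ` (\<Union>L\<in>(\<Union>r\<in>?S. elts r). elts L))"
    by (rule is_set_image)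
  moreover have "(\<lambda>\<delta>. cterm \<delta> 1) ` ?ON \<subseteq> (\<lambda>q. kfst (kfst q)) ` (\<Union>L\<in>(\<Union>r\<in>?S. elts r). elts L)"
  proof
    fix y assume "y \<in> (\<lambda>\<delta>. cterm \<delta> 1) ` ?ON"
    then obtain \<delta> where \<delta>: "is_ord \<delta>" "y = cterm \<delta> 1"
      by blast
    obtain l L where "transfinite_times_number l" "L \<in> elts (real_set l)"
      "kpair (kpair y (nat_ord 0)) z_one \<in> elts L"
      using ex_large_cut[OF \<delta>(1)] unfolding \<delta>(2) by blast
    then have "kpair (kpair y (nat_ord 0)) z_one \<in> (\<Union>L\<in>(\<Union>r\<in>?S. elts r). elts L)"
      by blast
    then show "y \<in> (\<lambda>q. kfst (kfst q)) ` (\<Union>L\<in>(\<Union>r\<in>?S. elts r). elts L)"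
      by (rule rev_image_eqI) simp
  qed
  ultimately have "is_set ((\<lambda>\<delta>. cterm \<delta> 1) ` ?ON)"
    by (rule is_set_mono)
  \<comment> \<open>The leading exponent of omega^\<delta> is \<delta>, so the map is injective, and
    replacement along its inverse returns the class of all ordinals.\<close>
  then have "is_set (inv_into ?ON (\<lambda>\<delta>. cterm \<delta> 1) ` (\<lambda>\<delta>. cterm \<delta> 1) ` ?ON)"
    by (rule is_set_image)
  moreover have "inj_on (\<lambda>\<delta>. cterm \<delta> 1) ?ON"
  proof (rule inj_onI)
    fix \<delta> \<epsilon> :: 'a assume ords: "\<delta> \<in> ?ON" "\<epsilon> \<in> ?ON" and eq: "cterm \<delta> 1 = cterm \<epsilon> 1"
    have "leading (z_coeff (kpair (cterm \<delta> 1) (nat_ord 0))) \<delta>"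
      "leading (z_coeff (kpair (cterm \<epsilon> 1) (nat_ord 0))) \<epsilon>"
      using ords leading_cterm(1)[OF _ zero_less_one] by blast+
    then show "\<delta> = \<epsilon>"
      unfolding eq by (rule leading_unique)
  qed
  ultimately have "is_set ?ON"
    by (simp only: inv_into_image_cancel subset_refl)
  then show False
    using proper_class_ords by blast
qed

theorem theorem11p19:
  "proper_class {real_set l |l :: 'a::mk_universe. transfinite_times_number l} \<and>
   proper_class {real_struct l |l :: 'a. transfinite_times_number l}"
proof
  let ?R = "{real_set l |l :: 'a. transfinite_times_number l}"
  let ?S = "{real_struct l |l :: 'a. transfinite_times_number l}"
  show R: "proper_class ?R"
    by (rule proper_class_real_sets)
  \<comment> \<open>The carrier is the first component, so replacement along \<open>kfst\<close>
    would turn a set of structures into a set of carriers.\<close>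
  have "kfst (real_struct l) = real_set l" for l :: 'a
    by (simp add: real_struct_def tuple8_def)
  then have eq: "?R = kfst ` ?S"
    by (auto simp: image_def)
  show "proper_class ?S"
    using R is_set_image[of ?S kfst] unfolding proper_class_def eq by blast
qed

end
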